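(* Let $f=p/q$ be a rational function on the standard simplex $\Delta\subset\mathbb{R}^n$, where $p,q$ are polynomials of total degree $l$, and suppose $b_\alpha(q,j,\Delta)>0$ for all $|\alpha|=j$ and all $j\ge l$. Then for every integer $k>l$, \[ d\big(f(\Delta),\,B(f,k,\Delta)\big)\le \frac{\omega}{k-1}, \] where \[ \omega:=\frac{n(n+2)\,l(l-1)}{24\,\min_{|\alpha|=l} b_\alpha(q,l,\Delta)}\Big(\|\nabla^2 p\|_\infty+\zeta\,\|\nabla^2 q\|_\infty\Big),\qquad \zeta:=\max\Big\{\big|\min_{|\alpha|=l} b_\alpha(f,l,\Delta)\big|,\ \big|\max_{|\alpha|=l} b_\alpha(f,l,\Delta)\big|\Big\}. \]
   Context: $\Delta=[e_0,e_1,\dots,e_n]$ is the standard simplex in $\mathbb{R}^n$ ($e_0$ the origin, $e_1,\dots,e_n$ the canonical basis), with barycentric coordinates $\lambda=(\lambda_0,\dots,\lambda_n)=(1-\sum_i x_i,x_1,\dots,x_n)$. For $\alpha\in\mathbb{N}^{n+1}$, $|\alpha|=\alpha_0+\dots+\alpha_n$. The Bernstein polynomials of degree $k$ on $\Delta$ are $B^{(k)}_\alpha=\frac{k!}{\alpha_0!\cdots\alpha_n!}\lambda^\alpha$, $|\alpha|=k$. A polynomial $p$ of degree $l\le k$ is uniquely written $p=\sum_{|\alpha|=k} b_\alpha(p,k,\Delta)B^{(k)}_\alpha$; the $b_\alpha(p,k,\Delta)$ are its Bernstein coefficients of degree $k$. For $f=p/q$ (numerator and denominator of the same degree $l$), the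 rational Bernstein coefficients are $b_\alpha(f,k,\Delta)=b_\alpha(p,k,\Delta)/b_\alpha(q,k,\Delta)$, and $B(f,k,\Delta):=[\min_{|\alpha|=k}b_\alpha(f,k,\Delta),\max_{|\alpha|=k}b_\alpha(f,k,\Delta)]$. $f(\Delta)=[\min_{\Delta}f,\max_\Delta f]$. For intervals, $d([\underline a,\overline a],[\underline b,\overline b])=\max\{|\underline a-\underline b|,|\overline a-\overline b|\}$. Second differences: with $\hat e_0,\dots,\hat e_n$ the unit vectors of $\mathbb{R}^{n+1}$ and convention $\hat e_{-1}:=\hat e_n$, for $\gamma\in\mathbb{N}^{n+1}$, $|\gamma|=l-2$, $0\le i<j\le n$, set $\nabla^2 b_{\gamma,i,j}(p,l,\Delta)=b_{\gamma+\hat e_i+\hat e_{j-1}}+b_{\gamma+\hat e_{i-1}+\hat e_j}-b_{\gamma+\hat e_{i-1}+\hat e_{j-1}}-b_{\gamma+\hat e_i+\hat e_j}$ (coefficients $b=b(p,l,\Delta)$), and $\|\nabla^2 p\|_\infty:=\max_{|\gamma|=l-2,\,0\le i<j\le n}|\nabla^2 b_{\gamma,i,j}(p,l,\Delta)|$; similarly for $q$. *)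

theory Defs
  imports "HOL-Analysis.Analysis"
begin

text \<open>Points of R^n are functions nat => real; only coordinates 1..n are used.
  Multi-indices in N^(n+1) are functions nat => nat supported on {0..n}.\<close>

definition multiidx :: "nat \<Rightarrow> nat \<Rightarrow> (nat \<Rightarrow> nat) set" where
  "multiidx n k = {\<alpha>. (\<forall>i>n. \<alpha> i = 0) \<and> (\<Sum>i\<le>n. \<alpha> i) = k}"

definition std_simplex :: "nat \<Rightarrow> (nat \<Rightarrow> real) set" where
  "std_simplex n = {x. (\<forall>i\<in>{1..n}. 0 \<le> x i) \<and> (\<Sum>i=1..n. x i) \<le> 1
                        \<and> (\<forall>i. i \<notin> {1..n} \<longrightarrow> x i = 0)}"

definition bary :: "nat \<Rightarrow> (nat \<Rightarrow> real) \<Rightarrow> nat \<Rightarrow> real" where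
  "bary n x i = (if i = 0 then 1 - (\<Sum>j=1..n. x j) else x i)"

definition bernstein :: "nat \<Rightarrow> nat \<Rightarrow> (nat \<Rightarrow> nat) \<Rightarrow> (nat \<Rightarrow> real) \<Rightarrow> real" where
  "bernstein n k \<alpha> x = (fact k / (\<Prod>i\<le>n. fact (\<alpha> i))) * (\<Prod>i\<le>n. bary n x i ^ \<alpha> i)"

definition mono_exps :: "nat \<Rightarrow> nat \<Rightarrow> (nat \<Rightarrow> nat) set" where
  "mono_exps n l = {\<beta>. (\<forall>i. i \<notin> {1..n} \<longrightarrow> \<beta> i = 0) \<and> (\<Sum>i=1..n. \<beta> i) \<le> l}"

definition mon_eval :: "nat \<Rightarrow> (nat \<Rightarrow> nat) \<Rightarrow> (nat \<Rightarrow> real) \<Rightarrow> real" where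
  "mon_eval n \<beta> x = (\<Prod>i=1..n. x i ^ \<beta> i)"

definition poly_of_degree :: "nat \<Rightarrow> nat \<Rightarrow> ((nat \<Rightarrow> real) \<Rightarrow> real) \<Rightarrow> bool" where
  "poly_of_degree n l p \<longleftrightarrow> (\<exists>c. p = (\<lambda>x. \<Sum>\<beta>\<in>mono_exps n l. c \<beta> * mon_eval n \<beta> x)
       \<and> (\<exists>\<beta>\<in>mono_exps n l. (\<Sum>i=1..n. \<beta> i) = l \<and> c \<beta> \<noteq> 0))"

definition bcoef :: "nat \<Rightarrow> nat \<Rightarrow> ((nat \<Rightarrow> real) \<Rightarrow> real) \<Rightarrow> (nat \<Rightarrow> nat) \<Rightarrow> real" where
  "bcoef n k p = (THE b. (\<forall>\<alpha>. \<alpha> \<notin> multiidx n k \<longrightarrow> b \<alpha> = 0) \<and>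
                          (\<forall>x. p x = (\<Sum>\<alpha>\<in>multiidx n k. b \<alpha> * bernstein n k \<alpha> x)))"

definition rbcoef :: "nat \<Rightarrow> nat \<Rightarrow> ((nat \<Rightarrow> real) \<Rightarrow> real) \<Rightarrow> ((nat \<Rightarrow> real) \<Rightarrow> real)
                      \<Rightarrow> (nat \<Rightarrow> nat) \<Rightarrow> real" where
  "rbcoef n k p q \<alpha> = bcoef n k p \<alpha> / bcoef n k q \<alpha>"

definition idist :: "real \<times> real \<Rightarrow> real \<times> real \<Rightarrow> real" where
  "idist A B = max \<bar>fst A - fst B\<bar> \<bar>snd A - snd B\<bar>"

definition bern_encl :: "nat \<Rightarrow> nat \<Rightarrow> ((nat \<Rightarrow> real) \<Rightarrow> real) \<Rightarrow> ((nat \<Rightarrow> real) \<Rightarrow> real)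
                         \<Rightarrow> real \<times> real" where
  "bern_encl n k p q = (Min (rbcoef n k p q ` multiidx n k), Max (rbcoef n k p q ` multiidx n k))"

definition range_on_simplex :: "nat \<Rightarrow> ((nat \<Rightarrow> real) \<Rightarrow> real) \<Rightarrow> real \<times> real" where
  "range_on_simplex n f = (Inf (f ` std_simplex n), Sup (f ` std_simplex n))"

definition unitv :: "nat \<Rightarrow> nat \<Rightarrow> nat" where
  "unitv i = (\<lambda>m. if m = i then 1 else 0)"

text \<open>Index i-1 with the cyclic convention e_{-1} = e_n.\<close>
definition prev_idx :: "nat \<Rightarrow> nat \<Rightarrow> nat" where
  "prev_idx n i = (if i = 0 then n else i - 1)"

definition addidx :: "(nat \<Rightarrow> nat) \<Rightarrow> nat \<Rightarrow> nat \<Rightarrow> nat \<Rightarrow> nat" where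
  "addidx \<gamma> a c = (\<lambda>m. \<gamma> m + unitv a m + unitv c m)"

definition nabla2 :: "nat \<Rightarrow> ((nat \<Rightarrow> nat) \<Rightarrow> real) \<Rightarrow> (nat \<Rightarrow> nat) \<Rightarrow> nat \<Rightarrow> nat \<Rightarrow> real" where
  "nabla2 n b \<gamma> i j =
     b (addidx \<gamma> i (j - 1)) + b (addidx \<gamma> (prev_idx n i) j)
   - b (addidx \<gamma> (prev_idx n i) (j - 1)) - b (addidx \<gamma> i j)"

text \<open>Sup-norm of second differences of the degree-l Bernstein coefficients
  (the max over an empty index set, i.e. l < 2, is taken as 0).\<close>
definition nabla2_norm :: "nat \<Rightarrow> nat \<Rightarrow> ((nat \<Rightarrow> real) \<Rightarrow> real) \<Rightarrow> real" where
  "nabla2_norm n l p = (if l < 2 then 0 else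
     Max {\<bar>nabla2 n (bcoef n l p) \<gamma> i j\<bar> | \<gamma> i j. \<gamma> \<in> multiidx n (l - 2) \<and> i < j \<and> j \<le> n})"

end

(* Let N = n + 1, k = |alpha| and regard alpha as an urn with alpha_i balls of colour i. The coefficient
   b_alpha(p,k) is the mean of b(p,l) over l draws from the urn without replacement (degree elevation),
   whereas p(alpha/k) is the mean over l draws with replacement (de Casteljau). Replace the draws one at
   a time: passing from m + 1 to m draws without replacement changes the mean by m/(2k) times an average
   of second differences of b in the directions e_i - e_j, where the pair (i, j) of distinct balls is
   uniformly distributed. Such a difference is a sum of s(N - s), s = |i - j|, cyclic mixed differences
   bounded by the norm of nabla^2, and the average of s(N - s) under alpha/k (with replacement) is at most
   n(n + 2)/6; requiring distinct balls costs a factor k/(k - 1). Summing over m < l gives the constant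
   l(l - 1)n(n + 2)/24 / (k - 1) for a polynomial. For f = p/q write
   b_p/b_q - p/q = ((b_p - p) + f (q - b_q)) / b_q at the node alpha/k, where |f| <= zeta. *)

theory Submission
  imports Defs "HOL-Computational_Algebra.Polynomial"
begin

section \<open>Sampling from a multi-index\<close>

definition up :: "nat \<Rightarrow> (nat \<Rightarrow> nat) \<Rightarrow> nat \<Rightarrow> nat" where
  "up i \<alpha> = \<alpha>(i := Suc (\<alpha> i))"

text \<open>At an empty colour the truncated subtraction leaves the index unchanged. In
  \<open>samp\<close> such a term carries the factor zero.\<close>

definition down :: "nat \<Rightarrow> (nat \<Rightarrow> nat) \<Rightarrow> nat \<Rightarrow> nat" where
  "down i \<alpha> = \<alpha>(i := \<alpha> i - 1)"

lemma up_apply: "up i \<alpha> j = (if j = i then Suc (\<alpha> i) else \<alpha> j)"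
  by (simp add: up_def)

lemma down_apply: "down i \<alpha> j = (if j = i then \<alpha> i - 1 else \<alpha> j)"
  by (simp add: down_def)

lemma up_commute: "up i (up j \<alpha>) = up j (up i \<alpha>)"
  by (auto simp: up_def fun_eq_iff)

lemma down_commute: "down i (down j \<alpha>) = down j (down i \<alpha>)"
  by (auto simp: down_def fun_eq_iff)

lemma down_up [simp]: "down i (up i \<alpha>) = \<alpha>"
  by (simp add: up_def down_def)

lemma up_down: "\<alpha> i > 0 \<Longrightarrow> up i (down i \<alpha>) = \<alpha>"
  by (simp add: up_def down_def)

lemma down_up_commute: "\<alpha> j > 0 \<Longrightarrow> down j (up i \<alpha>) = up i (down j \<alpha>)"
  by (auto simp: up_def down_def fun_eq_iff)

lemma addidx_eq_up: "addidx \<gamma> a c = up a (up c \<gamma>)"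
  by (auto simp: addidx_def unitv_def up_def fun_eq_iff)

lemma sum_up: "i \<le> n \<Longrightarrow> (\<Sum>j\<le>n. up i \<alpha> j) = Suc (\<Sum>j\<le>n. \<alpha> j)"
  by (simp add: up_def sum.remove[of "{..n}" i])

lemma sum_down: "i \<le> n \<Longrightarrow> \<alpha> i > 0 \<Longrightarrow> (\<Sum>j\<le>n. down i \<alpha> j) = (\<Sum>j\<le>n. \<alpha> j) - 1"
  using sum_up[of i n "down i \<alpha>"] by (simp add: up_down)

lemma up_multiidx: "i \<le> n \<Longrightarrow> \<alpha> \<in> multiidx n k \<Longrightarrow> up i \<alpha> \<in> multiidx n (Suc k)"
  using sum_up[of i n \<alpha>] by (auto simp: multiidx_def up_apply)

lemma down_multiidx: "i \<le> n \<Longrightarrow> \<alpha> i > 0 \<Longrightarrow> \<alpha> \<in> multiidx n (Suc k) \<Longrightarrow> down i \<alpha> \<in> multiidx n k"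
  using sum_down[of i n \<alpha>] by (auto simp: multiidx_def down_apply)

lemma multiidx_0 [simp]: "multiidx n 0 = {\<lambda>_. 0}"
proof -
  have "\<alpha> = (\<lambda>_. 0)" if "\<alpha> \<in> multiidx n 0" for \<alpha>
    using that by (auto simp: multiidx_def fun_eq_iff not_less) (metis atMost_iff not_le)
  then show ?thesis by (auto simp: multiidx_def)
qed

lemma multiidx_le: "\<alpha> \<in> multiidx n k \<Longrightarrow> \<alpha> i \<le> k"
  by (cases "i \<le> n") (auto simp: multiidx_def intro: member_le_sum[of i "{..n}" \<alpha>, simplified])

lemma finite_multiidx [simp]: "finite (multiidx n k)"
proof (rule finite_subset)
  show "multiidx n k \<subseteq> {\<alpha>. \<forall>i. (i \<in> {..n} \<longrightarrow> \<alpha> i \<in> {..k}) \<and> (i \<notin> {..n} \<longrightarrow> \<alpha> i = 0)}"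
    using multiidx_le by (auto simp: multiidx_def)
  show "finite {\<alpha>. \<forall>i. (i \<in> {..n} \<longrightarrow> \<alpha> i \<in> {..k}) \<and> (i \<notin> {..n} \<longrightarrow> \<alpha> i = (0::nat))}"
    by (rule finite_set_of_finite_funs) auto
qed

lemma multiidx_nonempty: "multiidx n k \<noteq> {}"
proof -
  have "(\<lambda>i. if i = 0 then k else 0) \<in> multiidx n k"
    by (auto simp: multiidx_def)
  then show ?thesis by blast
qed

text \<open>The sum, not the mean, over ordered \<open>m\<close>-draws without replacement from the urn \<open>\<alpha>\<close>;
  there are \<open>falling k m\<close> of them, where \<open>k = |\<alpha>|\<close>.\<close>

primrec samp :: "nat \<Rightarrow> nat \<Rightarrow> (nat \<Rightarrow> nat) \<Rightarrow> ((nat \<Rightarrow> nat) \<Rightarrow> real) \<Rightarrow> real" where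
  "samp n 0 \<alpha> f = f (\<lambda>_. 0)"
| "samp n (Suc m) \<alpha> f = (\<Sum>i\<le>n. real (\<alpha> i) * samp n m (down i \<alpha>) (\<lambda>\<gamma>. f (up i \<gamma>)))"

text \<open>One draw with replacement from the weights \<open>x\<close>. For barycentric coordinates
  this is one step of the de Casteljau scheme.\<close>

definition avg :: "nat \<Rightarrow> (nat \<Rightarrow> real) \<Rightarrow> ((nat \<Rightarrow> nat) \<Rightarrow> real) \<Rightarrow> (nat \<Rightarrow> nat) \<Rightarrow> real" where
  "avg n x f \<gamma> = (\<Sum>i\<le>n. x i * f (up i \<gamma>))"

text \<open>The falling factorial. Real factors avoid truncated subtraction, and the product
  vanishes for \<open>m > k\<close>, when no such draw exists.\<close>

definition falling :: "nat \<Rightarrow> nat \<Rightarrow> real" where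
  "falling k m = (\<Prod>r<m. real k - real r)"

lemma falling_0 [simp]: "falling k 0 = 1" by (simp add: falling_def)

lemma falling_Suc: "falling k (Suc m) = (real k - real m) * falling k m"
  by (simp add: falling_def mult.commute)

lemma falling_Suc_Suc: "falling (Suc k) (Suc m) = real (Suc k) * falling k m"
  by (simp add: falling_def prod.lessThan_Suc_shift o_def del: prod.lessThan_Suc)

lemma falling_pos: "m \<le> k \<Longrightarrow> falling k m > 0"
  by (auto simp: falling_def intro!: prod_pos)

lemma samp_linear:
  "samp n m \<alpha> (\<lambda>\<gamma>. \<Sum>i\<in>I. c i * g i \<gamma>) = (\<Sum>i\<in>I. c i * samp n m \<alpha> (g i))"
proof (induction m arbitrary: \<alpha> g)
  case (Suc m)
  have "samp n (Suc m) \<alpha> (\<lambda>\<gamma>. \<Sum>i\<in>I. c i * g i \<gamma>)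
      = (\<Sum>j\<le>n. \<Sum>i\<in>I. c i * (real (\<alpha> j) * samp n m (down j \<alpha>) (\<lambda>\<gamma>. g i (up j \<gamma>))))"
    by (simp add: Suc sum_distrib_left mult.left_commute)
  then show ?case by (simp add: sum.swap[of _ _ I] sum_distrib_left)
qed simp

lemma samp_combine:
  "samp n m \<alpha> (\<lambda>\<gamma>. c * f \<gamma> + d * g \<gamma>) = c * samp n m \<alpha> f + d * samp n m \<alpha> g"
  using samp_linear[of n m \<alpha> "\<lambda>i. if i then c else d" "\<lambda>i. if i then f else g" UNIV]
  by (simp add: UNIV_bool add.commute)

lemma samp_mono:
  "(\<And>\<gamma>. \<gamma> \<in> multiidx n m \<Longrightarrow> f \<gamma> \<le> g \<gamma>) \<Longrightarrow> samp n m \<alpha> f \<le> samp n m \<alpha> g"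
proof (induction m arbitrary: \<alpha> f g)
  case (Suc m)
  have "samp n m (down i \<alpha>) (\<lambda>\<gamma>. f (up i \<gamma>)) \<le> samp n m (down i \<alpha>) (\<lambda>\<gamma>. g (up i \<gamma>))" if "i \<le> n" for i
    using that by (intro Suc up_multiidx)
  then show ?case by (auto intro!: sum_mono mult_left_mono)
qed simp

text \<open>Double counting: instead of setting a ball aside and then drawing \<open>m\<close>, draw
  \<open>m\<close> first and choose the ball set aside among those left.\<close>

lemma samp_remove:
  "(\<Sum>i\<le>n. real (\<alpha> i) * samp n m (down i \<alpha>) f)
    = (real (\<Sum>i\<le>n. \<alpha> i) - real m) * samp n m \<alpha> f"
proof (induction m arbitrary: \<alpha> f)
  case 0
  then show ?case by (simp add: sum_distrib_right)
next
  case (Suc m)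
  have "(\<Sum>j\<le>n. real (\<alpha> j) * samp n (Suc m) (down j \<alpha>) f)
      = (\<Sum>j\<le>n. \<Sum>i\<le>n. real (\<alpha> j * down j \<alpha> i) * samp n m (down i (down j \<alpha>)) (\<lambda>\<gamma>. f (up i \<gamma>)))"
    by (simp add: sum_distrib_left mult.assoc)
  also have "\<dots> = (\<Sum>i\<le>n. \<Sum>j\<le>n. real (\<alpha> j * down j \<alpha> i) * samp n m (down i (down j \<alpha>)) (\<lambda>\<gamma>. f (up i \<gamma>)))"
    by (rule sum.swap)
  \<comment> \<open>The weight counts ordered pairs of distinct balls of colours \<open>i\<close>
    and \<open>j\<close>, hence is symmetric.\<close>
  also have "\<dots> = (\<Sum>i\<le>n. \<Sum>j\<le>n. real (\<alpha> i * down i \<alpha> j) * samp n m (down j (down i \<alpha>)) (\<lambda>\<gamma>. f (up i \<gamma>)))"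
    by (intro sum.cong refl) (simp add: down_commute, simp add: down_apply)
  also have "\<dots> = (\<Sum>i\<le>n. real (\<alpha> i) * (\<Sum>j\<le>n. real (down i \<alpha> j) * samp n m (down j (down i \<alpha>)) (\<lambda>\<gamma>. f (up i \<gamma>))))"
    by (simp add: sum_distrib_left mult.assoc)
  also have "\<dots> = (\<Sum>i\<le>n. (real (\<Sum>i\<le>n. \<alpha> i) - real (Suc m)) * (real (\<alpha> i) * samp n m (down i \<alpha>) (\<lambda>\<gamma>. f (up i \<gamma>))))"
  proof (intro sum.cong refl)
    fix i assume i: "i \<in> {..n}"
    show "real (\<alpha> i) * (\<Sum>j\<le>n. real (down i \<alpha> j) * samp n m (down j (down i \<alpha>)) (\<lambda>\<gamma>. f (up i \<gamma>)))
      = (real (\<Sum>i\<le>n. \<alpha> i) - real (Suc m)) * (real (\<alpha> i) * samp n m (down i \<alpha>) (\<lambda>\<gamma>. f (up i \<gamma>)))"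
    proof (cases "\<alpha> i = 0")
      case False
      have "\<alpha> i \<le> (\<Sum>i\<le>n. \<alpha> i)" using i by (intro member_le_sum) auto
      then have "real (\<Sum>j\<le>n. down i \<alpha> j) = real (\<Sum>i\<le>n. \<alpha> i) - 1"
        using sum_down[of i n \<alpha>] i False by (simp del: of_nat_sum add: of_nat_diff)
      then show ?thesis unfolding Suc by simp
    qed simp
  qed
  finally show ?case by (simp add: sum_distrib_left)
qed

lemma samp_const: "samp n m \<alpha> (\<lambda>_. c) = c * falling (\<Sum>i\<le>n. \<alpha> i) m"
  by (induction m) (simp_all add: samp_remove falling_Suc del: of_nat_sum)

text \<open>The extra ball is either never drawn or sits at one of the \<open>m\<close> positions.
  For \<open>m = 0\<close> the factor \<open>real m\<close> removes the truncated
  \<open>m - 1\<close>.\<close>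

lemma samp_up:
  assumes "i \<le> n"
  shows "samp n m (up i \<alpha>) f = samp n m \<alpha> f + real m * samp n (m - 1) \<alpha> (\<lambda>\<gamma>. f (up i \<gamma>))"
proof (induction m arbitrary: \<alpha> f)
  case (Suc m)
  \<comment> \<open>Split by the first ball, of colour \<open>j\<close>: an old ball with the new
    one never drawn, an old ball with the new one drawn later, or the new ball itself.\<close>
  have *: "real (up i \<alpha> j) * samp n m (down j (up i \<alpha>)) (\<lambda>\<gamma>. f (up j \<gamma>))
     = real (\<alpha> j) * samp n m (down j \<alpha>) (\<lambda>\<gamma>. f (up j \<gamma>))
       + real m * (real (\<alpha> j) * samp n (m - 1) (down j \<alpha>) (\<lambda>\<gamma>. f (up i (up j \<gamma>))))
       + (if j = i then samp n m \<alpha> (\<lambda>\<gamma>. f (up i \<gamma>)) else 0)" for j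
  proof (cases "\<alpha> j = 0")
    case True
    then show ?thesis by (cases "j = i") (simp_all add: up_apply)
  next
    case False
    have "samp n m (down j (up i \<alpha>)) (\<lambda>\<gamma>. f (up j \<gamma>)) = samp n m (down j \<alpha>) (\<lambda>\<gamma>. f (up j \<gamma>))
        + real m * samp n (m - 1) (down j \<alpha>) (\<lambda>\<gamma>. f (up i (up j \<gamma>)))"
      using False Suc[of "down j \<alpha>" "\<lambda>\<gamma>. f (up j \<gamma>)"] by (simp add: down_up_commute up_commute)
    moreover have "real (up i \<alpha> j) = real (\<alpha> j) + (if j = i then 1 else 0)"
      by (simp add: up_apply)
    ultimately show ?thesis by (auto simp: algebra_simps)
  qed
  have "samp n (Suc m) (up i \<alpha>) f = samp n (Suc m) \<alpha> f
      + real m * (\<Sum>j\<le>n. real (\<alpha> j) * samp n (m - 1) (down j \<alpha>) (\<lambda>\<gamma>. f (up i (up j \<gamma>))))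
      + samp n m \<alpha> (\<lambda>\<gamma>. f (up i \<gamma>))"
    using assms by (simp add: * sum.distrib sum_distrib_left)
  also have "real m * (\<Sum>j\<le>n. real (\<alpha> j) * samp n (m - 1) (down j \<alpha>) (\<lambda>\<gamma>. f (up i (up j \<gamma>))))
      = real m * samp n m \<alpha> (\<lambda>\<gamma>. f (up i \<gamma>))"
    by (cases m) auto
  finally show ?case by (simp add: algebra_simps)
qed simp

text \<open>The square of the direction e_i - e_j applied to \<open>f\<close>; the base index has
  degree two less than the arguments of \<open>f\<close>.\<close>

definition diff2 :: "((nat \<Rightarrow> nat) \<Rightarrow> real) \<Rightarrow> nat \<Rightarrow> nat \<Rightarrow> (nat \<Rightarrow> nat) \<Rightarrow> real" where
  "diff2 f i j \<gamma> = f (up i (up i \<gamma>)) + f (up j (up j \<gamma>)) - 2 * f (up i (up j \<gamma>))"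

text \<open>The ball drawn with replacement is either new, which gives a draw of
  \<open>m + 2\<close> balls without replacement, or repeats one of the \<open>m + 1\<close> others.
  In the second case the repeated ball is paired with a spare one outside the draw, and exchanging
  the two produces \<open>diff2\<close>. The denominators in \<open>k\<close> are cleared.\<close>

lemma samp_step:
  fixes n :: nat and \<alpha> :: "nat \<Rightarrow> nat"
  defines "k \<equiv> \<Sum>i\<le>n. \<alpha> i"
  shows "(real k - real (Suc m)) * (\<Sum>i\<le>n. real (\<alpha> i) * samp n (Suc m) \<alpha> (\<lambda>\<gamma>. f (up i \<gamma>)))
     = real k * samp n (Suc (Suc m)) \<alpha> f
       + real (Suc m) / 2 * (\<Sum>i\<le>n. \<Sum>j\<le>n. real (\<alpha> i * down i \<alpha> j) * samp n m (down j (down i \<alpha>)) (diff2 f i j))"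
proof -
  define W where "W i j = real (\<alpha> i * down i \<alpha> j)" for i j
  define S where "S i j a b = W i j * samp n m (down j (down i \<alpha>)) (\<lambda>\<gamma>. f (up a (up b \<gamma>)))" for i j a b
  have Wsym: "W i j = W j i" for i j by (simp add: W_def down_apply)
  have Ssym: "S i j a b = S j i b a" for i j a b
    unfolding S_def by (subst Wsym, subst down_commute, subst up_commute) (rule refl)
  \<comment> \<open>The factor k - (m + 1) counts the spare balls: one ball is removed and
    \<open>m\<close> are drawn from the rest.\<close>
  have k1: "(real k - real (Suc m)) * (real (\<alpha> i) * samp n m (down i \<alpha>) g)
      = (\<Sum>j\<le>n. W i j * samp n m (down j (down i \<alpha>)) g)" if "i \<le> n" for i g
  proof (cases "\<alpha> i = 0")
    case False
    have "\<alpha> i \<le> k" unfolding k_def using that by (intro member_le_sum) auto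
    then have "real (\<Sum>j\<le>n. down i \<alpha> j) = real k - 1"
      using sum_down[of i n \<alpha>] that False by (simp del: of_nat_sum add: of_nat_diff k_def)
    then have "(real k - real (Suc m)) * samp n m (down i \<alpha>) g
        = (\<Sum>j\<le>n. real (down i \<alpha> j) * samp n m (down j (down i \<alpha>)) g)"
      unfolding samp_remove by simp
    then show ?thesis by (simp add: W_def mult.assoc sum_distrib_left[symmetric] mult.left_commute)
  qed (simp add: W_def)
  \<comment> \<open>Single out one ball of colour \<open>i\<close> and ask whether it is among the
    \<open>m + 1\<close> drawn.\<close>
  have one: "real (\<alpha> i) * samp n (Suc m) \<alpha> g = real (\<alpha> i) * samp n (Suc m) (down i \<alpha>) g
      + real (Suc m) * (real (\<alpha> i) * samp n m (down i \<alpha>) (\<lambda>\<gamma>. g (up i \<gamma>)))" if "i \<le> n" for i g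
    using samp_up[OF that, of "Suc m" "down i \<alpha>" g]
    by (cases "\<alpha> i = 0") (simp_all add: up_down algebra_simps del: samp.simps)
  have two: "samp n (Suc (Suc m)) \<alpha> f = (\<Sum>i\<le>n. \<Sum>j\<le>n. S i j i j)"
    by (simp add: sum_distrib_left S_def W_def mult.assoc)
  have "(\<Sum>i\<le>n. real (\<alpha> i) * samp n (Suc m) \<alpha> (\<lambda>\<gamma>. f (up i \<gamma>)))
      = samp n (Suc (Suc m)) \<alpha> f
        + real (Suc m) * (\<Sum>i\<le>n. real (\<alpha> i) * samp n m (down i \<alpha>) (\<lambda>\<gamma>. f (up i (up i \<gamma>))))"
    unfolding samp.simps(2)[of n "Suc m" \<alpha>]
    by (simp add: one sum.distrib sum_distrib_left del: samp.simps of_nat_Suc)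
  moreover have "(real k - real (Suc m)) * (\<Sum>i\<le>n. real (\<alpha> i) * samp n m (down i \<alpha>) (\<lambda>\<gamma>. f (up i (up i \<gamma>))))
      = (\<Sum>i\<le>n. \<Sum>j\<le>n. S i j i i)"
    unfolding sum_distrib_left by (intro sum.cong refl) (subst k1, auto simp: S_def)
  ultimately have "(real k - real (Suc m)) * (\<Sum>i\<le>n. real (\<alpha> i) * samp n (Suc m) \<alpha> (\<lambda>\<gamma>. f (up i \<gamma>)))
     = (real k - real (Suc m)) * samp n (Suc (Suc m)) \<alpha> f + real (Suc m) * (\<Sum>i\<le>n. \<Sum>j\<le>n. S i j i i)"
    by (simp only: distrib_left mult.left_commute)
  \<comment> \<open>Writing k - (m + 1) as \<open>k\<close> minus m + 1 frees the mixed terms that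
    \<open>diff2\<close> subtracts.\<close>
  also have "\<dots> = real k * samp n (Suc (Suc m)) \<alpha> f
      + real (Suc m) * ((\<Sum>i\<le>n. \<Sum>j\<le>n. S i j i i) - (\<Sum>i\<le>n. \<Sum>j\<le>n. S i j i j))"
    unfolding two by (simp add: algebra_simps)
  also have "(\<Sum>i\<le>n. \<Sum>j\<le>n. S i j i i) - (\<Sum>i\<le>n. \<Sum>j\<le>n. S i j i j)
      = (\<Sum>i\<le>n. \<Sum>j\<le>n. W i j * samp n m (down j (down i \<alpha>)) (diff2 f i j)) / 2"
  proof -
    \<comment> \<open>Exchanging the two balls shows that both pure terms of \<open>diff2\<close>
      have the same total, whence the factor 1/2.\<close>
    have "(\<Sum>i\<le>n. \<Sum>j\<le>n. S i j j j) = (\<Sum>i\<le>n. \<Sum>j\<le>n. S i j i i)"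
      by (subst sum.swap) (intro sum.cong refl Ssym)
    moreover have "W i j * samp n m (down j (down i \<alpha>)) (diff2 f i j) = S i j i i + S i j j j - 2 * S i j i j" for i j
    proof -
      have "diff2 f i j = (\<lambda>\<gamma>. 1 * (1 * f (up i (up i \<gamma>)) + 1 * f (up j (up j \<gamma>))) + (-2) * f (up i (up j \<gamma>)))"
        by (auto simp: diff2_def)
      then show ?thesis by (simp only: samp_combine S_def) (simp add: algebra_simps)
    qed
    ultimately show ?thesis by (simp add: sum.distrib sum_subtractf flip: sum_distrib_left)
  qed
  finally show ?thesis by (simp add: W_def)
qed

section \<open>Repeated draws with replacement\<close>

lemma avg_commute_up: "avg n x (\<lambda>\<gamma>. f (up i \<gamma>)) = (\<lambda>\<gamma>. avg n x f (up i \<gamma>))"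
  by (simp add: avg_def up_commute fun_eq_iff)

lemma avg_pow_commute_up: "(avg n x ^^ r) (\<lambda>\<gamma>. f (up i \<gamma>)) = (\<lambda>\<gamma>. (avg n x ^^ r) f (up i \<gamma>))"
  by (induction r) (simp_all add: avg_commute_up)

lemma avg_diff2: "diff2 (avg n x f) i j = avg n x (diff2 f i j)"
proof
  fix \<gamma>
  have "up a (up b (up c \<gamma>)) = up c (up a (up b \<gamma>))" for a b c
    by (metis up_commute)
  then have "diff2 f i j (up c \<gamma>) = f (up c (up i (up i \<gamma>))) + f (up c (up j (up j \<gamma>))) - 2 * f (up c (up i (up j \<gamma>)))" for c
    by (simp only: diff2_def)
  then show "diff2 (avg n x f) i j \<gamma> = avg n x (diff2 f i j) \<gamma>"
    by (simp add: avg_def diff2_def[of "avg n x f"] right_diff_distrib distrib_left sum_subtractf sum.distrib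
        sum_distrib_left mult.left_commute)
qed

lemma avg_pow_diff2: "diff2 ((avg n x ^^ r) f) i j = (avg n x ^^ r) (diff2 f i j)"
  by (induction r) (simp_all add: avg_diff2)

text \<open>A convex combination keeps a bound. Each averaging lowers the degree by one, so the
  bound is assumed at degree \<open>m + r\<close>.\<close>

lemma avg_pow_bound:
  assumes "\<And>i. i \<le> n \<Longrightarrow> x i \<ge> 0" "(\<Sum>i\<le>n. x i) = 1"
    and "\<And>\<gamma>. \<gamma> \<in> multiidx n (m + r) \<Longrightarrow> \<bar>f \<gamma>\<bar> \<le> c"
    and "\<gamma> \<in> multiidx n m"
  shows "\<bar>(avg n x ^^ r) f \<gamma>\<bar> \<le> c"
  using assms(3,4)
proof (induction r arbitrary: m \<gamma>)
  case (Suc r)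
  have "\<bar>(avg n x ^^ Suc r) f \<gamma>\<bar> \<le> (\<Sum>i\<le>n. \<bar>x i * (avg n x ^^ r) f (up i \<gamma>)\<bar>)"
    by (simp add: avg_def sum_abs)
  also have "\<dots> \<le> (\<Sum>i\<le>n. x i * c)"
  proof (intro sum_mono)
    fix i assume i: "i \<in> {..n}"
    have "\<bar>(avg n x ^^ r) f (up i \<gamma>)\<bar> \<le> c"
      by (rule Suc.IH[of "Suc m"]) (use Suc.prems i in \<open>auto intro: up_multiidx\<close>)
    then show "\<bar>x i * (avg n x ^^ r) f (up i \<gamma>)\<bar> \<le> x i * c"
      using assms(1) i by (auto simp: abs_mult intro: mult_left_mono)
  qed
  also have "\<dots> = c" using assms(2) by (simp add: sum_distrib_right[symmetric])
  finally show ?case .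
qed simp

section \<open>Second differences along edges of the simplex\<close>

text \<open>On the cycle of \<open>n + 1\<close> colours, \<open>a\<close> and \<open>b\<close> cut
  two arcs; the product of their lengths is the number of mixed differences needed in
  \<open>diff2_bound\<close>.\<close>

definition arc_product :: "nat \<Rightarrow> nat \<Rightarrow> nat \<Rightarrow> real" where
  "arc_product n a b = \<bar>real a - real b\<bar> * (real (n + 1) - \<bar>real a - real b\<bar>)"

lemma arc_product_commute: "arc_product n a b = arc_product n b a"
  by (simp add: arc_product_def abs_minus_commute)

lemma arc_product_self [simp]: "arc_product n a a = 0"
  by (simp add: arc_product_def)

lemma arc_product_nonneg: "a \<le> n \<Longrightarrow> b \<le> n \<Longrightarrow> arc_product n a b \<ge> 0"
  by (auto simp: arc_product_def intro!: mult_nonneg_nonneg)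

text \<open>The wrap-around at index 0 contributes the term in \<open>n\<close>; for
  \<open>m = n\<close> the cyclic differences sum to zero.\<close>

lemma sum_cyclic_diff:
  fixes g :: "nat \<Rightarrow> real"
  shows "(\<Sum>j\<le>m. g j - g (prev_idx n j)) = g m - g n"
  by (induction m) (auto simp: prev_idx_def)

lemma sum_interval_diff:
  fixes g :: "nat \<Rightarrow> real"
  assumes "b \<le> a"
  shows "(\<Sum>j\<in>{b<..a}. g j - g (prev_idx n j)) = g a - g b"
  using assms
proof (induction a rule: dec_induct)
  case (step a)
  have "{b<..Suc a} = insert (Suc a) {b<..a}" using step by auto
  then show ?case using step by (simp add: prev_idx_def)
qed simp

text \<open>Since \<open>i < j\<close> forces \<open>j > 0\<close>, the index \<open>j - 1\<close>
  is the cyclic predecessor, and \<open>nabla2\<close> is minus a product of two cyclic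
  differences.\<close>

lemma nabla2_eq_mixed_diff:
  assumes "i < j"
  shows "nabla2 n f \<gamma> i j = - ((f (up i (up j \<gamma>)) - f (up (prev_idx n i) (up j \<gamma>)))
     - (f (up i (up (prev_idx n j) \<gamma>)) - f (up (prev_idx n i) (up (prev_idx n j) \<gamma>))))"
  using assms by (simp add: nabla2_def addidx_eq_up prev_idx_def)

text \<open>Since the cyclic differences \<open>D\<^sub>i = e\<^sub>i - e\<^sub>i\<^sub>-\<^sub>1\<close> sum to zero,
  \<open>e\<^sub>a - e\<^sub>b\<close> is both the sum of the \<open>D\<^sub>i\<close> over \<open>b < i \<le> a\<close> and minus the sum of the others;
  multiplying the two expressions writes its square through the mixed products \<open>-D\<^sub>i D\<^sub>j\<close> only.\<close>

lemma diff2_bound: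
  assumes M: "\<And>i j. i < j \<Longrightarrow> j \<le> n \<Longrightarrow> \<bar>nabla2 n f \<gamma> i j\<bar> \<le> M"
    and "a \<le> n" "b \<le> n"
  shows "\<bar>diff2 f a b \<gamma>\<bar> \<le> arc_product n a b * M"
proof -
  define F where "F i j = f (up i (up j \<gamma>))" for i j
  have Fsym: "F i j = F j i" for i j by (simp add: F_def up_commute)
  define DD where "DD i j = (F i j - F (prev_idx n i) j) - (F i (prev_idx n j) - F (prev_idx n i) (prev_idx n j))" for i j
  have DDsym: "DD i j = DD j i" for i j
    by (simp add: DD_def Fsym[of _ i] Fsym[of _ "prev_idx n i"])
  have DD: "\<bar>DD i j\<bar> \<le> M" if "i \<noteq> j" "i \<le> n" "j \<le> n" for i j
  proof -
    \<comment> \<open>The hypothesis covers \<open>i < j\<close> only; the symmetry of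
      \<open>DD\<close> gives the other order.\<close>
    have *: "\<bar>DD i j\<bar> \<le> M" if "i < j" "j \<le> n" for i j
      using M[OF that] unfolding nabla2_eq_mixed_diff[OF that(1)] by (simp add: DD_def F_def)
    show ?thesis using that *[of i j] *[of j i] DDsym[of i j] by (cases "i < j") auto
  qed
  have main: "\<bar>diff2 f a b \<gamma>\<bar> \<le> arc_product n a b * M" if ab: "b \<le> a" "a \<le> n" for a b
  proof -
    define I where "I = {b<..a}"
    define G where "G j = F a j - F b j" for j
    have I: "(\<Sum>i\<in>I. DD i j) = G j - G (prev_idx n j)" for j
      using sum_interval_diff[OF ab(1), of "\<lambda>i. F i j" n]
        sum_interval_diff[OF ab(1), of "\<lambda>i. F i (prev_idx n j)" n]
      unfolding DD_def G_def I_def sum_subtractf by simp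
    \<comment> \<open>The indices \<open>j\<close> run over the complementary arc, so the pairs
      \<open>i\<close>, \<open>j\<close> are always distinct and no diagonal \<open>DD i i\<close>
      occurs.\<close>
    have "(\<Sum>j\<in>{..n} - I. G j - G (prev_idx n j)) = (\<Sum>j\<le>n. G j - G (prev_idx n j)) - (\<Sum>j\<in>I. G j - G (prev_idx n j))"
      using ab by (intro sum_diff) (auto simp: I_def)
    also have "\<dots> = G b - G a"
      unfolding I_def using ab by (simp only: sum_interval_diff sum_cyclic_diff)
    also have "\<dots> = - diff2 f a b \<gamma>"
      using Fsym[of a b] by (simp add: G_def diff2_def F_def)
    finally have eq: "diff2 f a b \<gamma> = - (\<Sum>j\<in>{..n} - I. \<Sum>i\<in>I. DD i j)"
      by (simp add: I)
    have "\<bar>diff2 f a b \<gamma>\<bar> \<le> (\<Sum>j\<in>{..n} - I. \<bar>\<Sum>i\<in>I. DD i j\<bar>)"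
      unfolding eq by (simp add: sum_abs)
    also have "\<dots> \<le> (\<Sum>j\<in>{..n} - I. \<Sum>i\<in>I. \<bar>DD i j\<bar>)"
      by (intro sum_mono sum_abs)
    also have "\<dots> \<le> (\<Sum>j\<in>{..n} - I. \<Sum>i\<in>I. M)"
      using ab by (intro sum_mono DD) (auto simp: I_def)
    also have "\<dots> = arc_product n a b * M"
    proof -
      have "card ({..n} - I) = Suc n - (a - b)"
        using ab by (subst card_Diff_subset) (auto simp: I_def intro: order_trans)
      then show ?thesis using ab by (simp add: arc_product_def I_def of_nat_diff)
    qed
    finally show ?thesis .
  qed
  show ?thesis
  proof (cases "b \<le> a")
    case False
    have "diff2 f a b \<gamma> = diff2 f b a \<gamma>" by (simp add: diff2_def up_commute)
    then show ?thesis using False main[of a b] assms arc_product_commute[of n a b] by simp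
  qed (use main assms in auto)
qed

section \<open>The energy of the arc kernel\<close>

lemma sum_indicator_le:
  fixes g :: "nat \<Rightarrow> real"
  assumes "a \<le> n"
  shows "(\<Sum>i\<le>n. if i \<le> a then g i else 0) = (\<Sum>i\<le>a. g i)"
proof -
  have "{..n} \<inter> {i. i \<le> a} = {..a}" using assms by auto
  then show ?thesis by (simp add: sum.If_cases)
qed

lemma sum_of_nat_id: "(\<Sum>i\<le>n. real i) = real n * (real n + 1) / 2"
  by (induction n) (auto simp: field_simps)

lemma sum_of_nat_sq: "(\<Sum>i\<le>n. (real i)\<^sup>2) = real n * (real n + 1) * (2 * real n + 1) / 6"
  by (induction n) (auto simp: field_simps power2_eq_square)

text \<open>The kernel \<open>arc_product\<close> is cyclically invariant and conditionally negative definite, so its energy is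
  largest at the uniform distribution. With the tail sums \<open>X\<close> of the distribution and \<open>c\<close> those of the
  uniform one, this is the Cauchy--Schwarz inequality for \<open>X - c\<close>.\<close>

lemma arc_product_energy:
  fixes x :: "nat \<Rightarrow> real"
  assumes x1: "(\<Sum>i\<le>n. x i) = 1"
  shows "(\<Sum>a\<le>n. \<Sum>b\<le>n. x a * x b * arc_product n a b) \<le> real (n * (n + 2)) / 6"
proof -
  define N where "N = real (n + 1)"
  have N: "N > 0" by (simp add: N_def)
  define u where "u i a = (if i \<le> a then 1 else 0 :: real)" for i a :: nat
  define X where "X i = (\<Sum>a\<le>n. u i a * x a)" for i
  define \<mu> where "\<mu> = (\<Sum>a\<le>n. real a * x a)"
  define q where "q = (\<Sum>a\<le>n. (real a)\<^sup>2 * x a)"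
  define c where "c i = 1 - real i / N" for i :: nat
  \<comment> \<open>Summation by parts: weighted sums of the tails become moments of
    \<open>x\<close>.\<close>
  have XL: "(\<Sum>i\<le>n. g i * X i) = (\<Sum>a\<le>n. (\<Sum>i\<le>a. g i) * x a)" for g
  proof -
    have "(\<Sum>i\<le>n. g i * X i) = (\<Sum>i\<le>n. \<Sum>a\<le>n. g i * u i a * x a)"
      by (simp add: X_def sum_distrib_left mult.assoc)
    also have "\<dots> = (\<Sum>a\<le>n. \<Sum>i\<le>n. g i * u i a * x a)" by (rule sum.swap)
    also have "\<dots> = (\<Sum>a\<le>n. (\<Sum>i\<le>n. g i * u i a) * x a)" by (simp add: sum_distrib_right)
    also have "\<dots> = (\<Sum>a\<le>n. (\<Sum>i\<le>n. if i \<le> a then g i else 0) * x a)"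
      by (simp add: u_def if_distrib cong: if_cong)
    finally show ?thesis by (simp add: sum_indicator_le)
  qed
  have SX: "(\<Sum>i\<le>n. X i) = \<mu> + 1"
    using XL[of "\<lambda>_. 1"] x1 by (simp add: \<mu>_def algebra_simps sum.distrib)
  have SiX: "(\<Sum>i\<le>n. real i * X i) = (q + \<mu>) / 2"
    unfolding XL sum_of_nat_id q_def \<mu>_def sum.distrib[symmetric] sum_divide_distrib
    by (intro sum.cong) (auto simp: power2_eq_square algebra_simps)
  have Sc: "(\<Sum>i\<le>n. c i) = (N + 1) / 2"
    using N unfolding c_def sum_subtractf sum_divide_distrib[symmetric] sum_of_nat_id
    by (simp add: N_def field_simps)
  have Sc2: "N * (\<Sum>i\<le>n. (c i)\<^sup>2) = N\<^sup>2 - (N - 1) * N + (N - 1) * (2 * N - 1) / 6"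
  proof -
    have "(\<Sum>i\<le>n. (c i)\<^sup>2) = (\<Sum>i\<le>n. 1 - 2 / N * real i + 1 / N\<^sup>2 * (real i)\<^sup>2)"
      by (simp add: c_def power2_eq_square algebra_simps)
    also have "\<dots> = N - 2 / N * (real n * (real n + 1) / 2) + 1 / N\<^sup>2 * (real n * (real n + 1) * (2 * real n + 1) / 6)"
      unfolding sum.distrib sum_subtractf sum_distrib_left[symmetric] sum_of_nat_id sum_of_nat_sq
      by (simp add: N_def)
    finally have eq: "(\<Sum>i\<le>n. (c i)\<^sup>2) = N - 2 / N * ((N - 1) * N / 2) + 1 / N\<^sup>2 * ((N - 1) * N * (2 * N - 1) / 6)"
      by (simp add: N_def algebra_simps)
    show ?thesis unfolding eq using N by (simp add: field_simps power2_eq_square)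
  qed
  have ScX: "(\<Sum>i\<le>n. c i * X i) = \<mu> + 1 - (q + \<mu>) / (2 * N)"
  proof -
    have "(\<Sum>i\<le>n. c i * X i) = (\<Sum>i\<le>n. X i) - (\<Sum>i\<le>n. real i * X i) / N"
      by (simp add: c_def left_diff_distrib sum_subtractf sum_divide_distrib)
    then show ?thesis unfolding SX SiX by simp
  qed
  have CS: "(\<Sum>i\<le>n. X i - c i)\<^sup>2 \<le> N * (\<Sum>i\<le>n. (X i - c i)\<^sup>2)"
    using sum_squared_le_sum_of_squares[of "\<lambda>i. X i - c i" "{..n}"]
    by (simp add: N_def mult.commute)
  have SXc2: "(\<Sum>i\<le>n. (X i - c i)\<^sup>2) = (\<Sum>i\<le>n. (X i)\<^sup>2) - 2 * (\<Sum>i\<le>n. c i * X i) + (\<Sum>i\<le>n. (c i)\<^sup>2)"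
    by (simp add: power2_diff sum.distrib sum_subtractf sum_distrib_left mult_ac)
  \<comment> \<open>The kernel is N |a - b| - (a - b)^2, and |a - b| counts the thresholds
    \<open>i\<close> that separate \<open>a\<close> from \<open>b\<close>.\<close>
  have k: "arc_product n a b = N * (\<Sum>i\<le>n. u i a + u i b - 2 * (u i a * u i b)) - ((real a)\<^sup>2 + (real b)\<^sup>2 - 2 * (real a * real b))"
    if "a \<le> n" "b \<le> n" for a b
  proof -
    have *: "(\<Sum>i\<le>n. u i a) = real a + 1" if "a \<le> n" for a
      using sum_indicator_le[OF that, of "\<lambda>_. 1"] by (simp add: u_def)
    have "(\<Sum>i\<le>n. u i a * u i b) = (\<Sum>i\<le>n. u i (min a b))"
      by (intro sum.cong) (auto simp: u_def)
    then have "(\<Sum>i\<le>n. u i a + u i b - 2 * (u i a * u i b)) = real a + 1 + (real b + 1) - 2 * (real (min a b) + 1)"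
      unfolding sum_subtractf sum.distrib sum_distrib_left[symmetric]
      using *[of a] *[of b] *[of "min a b"] that by simp
    also have "\<dots> = \<bar>real a - real b\<bar>" by (auto simp: min_def)
    finally show ?thesis
      by (simp add: arc_product_def N_def power2_eq_square algebra_simps abs_if)
  qed
  \<comment> \<open>\<open>E\<close> is the expectation over two independent colours with weights
    \<open>x\<close>, so products of one-variable functions factor.\<close>
  define E where "E h = (\<Sum>a\<le>n. \<Sum>b\<le>n. x a * x b * h a b)" for h :: "nat \<Rightarrow> nat \<Rightarrow> real"
  have E_diff: "E (\<lambda>a b. f a b - g a b) = E f - E g" for f g
    by (simp add: E_def right_diff_distrib sum_subtractf)
  have E_add: "E (\<lambda>a b. f a b + g a b) = E f + E g" for f g
    by (simp add: E_def distrib_left sum.distrib)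
  have E_scale: "E (\<lambda>a b. t * f a b) = t * E f" for t f
    by (simp add: E_def sum_distrib_left mult.left_commute)
  have E_sum: "E (\<lambda>a b. \<Sum>i\<le>n. f i a b) = (\<Sum>i\<le>n. E (f i))" for f
  proof -
    have "E (\<lambda>a b. \<Sum>i\<le>n. f i a b) = (\<Sum>a\<le>n. \<Sum>i\<le>n. \<Sum>b\<le>n. x a * x b * f i a b)"
      unfolding E_def sum_distrib_left by (intro sum.cong refl sum.swap)
    also have "\<dots> = (\<Sum>i\<le>n. E (f i))" unfolding E_def by (rule sum.swap)
    finally show ?thesis .
  qed
  have E_prod: "E (\<lambda>a b. g a * h b) = (\<Sum>a\<le>n. g a * x a) * (\<Sum>b\<le>n. h b * x b)" for g h
    by (simp add: E_def sum_product mult_ac)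
  have E_left: "E (\<lambda>a b. g a) = (\<Sum>a\<le>n. g a * x a)" and E_right: "E (\<lambda>a b. g b) = (\<Sum>b\<le>n. g b * x b)" for g
    using E_prod[of g "\<lambda>_. 1"] E_prod[of "\<lambda>_. 1" g] x1 by simp_all
  have "(\<Sum>a\<le>n. \<Sum>b\<le>n. x a * x b * arc_product n a b)
      = E (\<lambda>a b. N * (\<Sum>i\<le>n. u i a + u i b - 2 * (u i a * u i b)) - ((real a)\<^sup>2 + (real b)\<^sup>2 - 2 * (real a * real b)))"
    unfolding E_def by (intro sum.cong refl) (simp only: k atMost_iff)
  also have "\<dots> = N * (\<Sum>i\<le>n. X i + X i - 2 * (X i * X i)) - (q + q - 2 * (\<mu> * \<mu>))"
    by (simp only: E_diff E_add E_scale E_sum E_prod E_left E_right X_def q_def \<mu>_def)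
  also have "\<dots> = 2 * (N * (\<mu> + 1) - q + \<mu>\<^sup>2 - N * (\<Sum>i\<le>n. (X i)\<^sup>2))"
    unfolding sum_subtractf sum.distrib sum_distrib_left[symmetric] SX
    by (simp add: power2_eq_square algebra_simps)
  \<comment> \<open>Once Cauchy-Schwarz is expanded, all terms in \<open>\<mu>\<close>,
    \<open>q\<close> and the squares of \<open>X\<close> cancel, and only a constant in
    \<open>N\<close> remains.\<close>
  also have "\<dots> \<le> (N\<^sup>2 - 1) / 6"
  proof -
    have "N * (2 * (\<Sum>i\<le>n. c i * X i)) = 2 * N * (\<mu> + 1) - (q + \<mu>)"
      unfolding ScX using N by (simp add: field_simps)
    moreover have "(\<Sum>i\<le>n. X i - c i) = \<mu> + 1 - (N + 1) / 2"
      by (simp only: sum_subtractf SX Sc)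
    ultimately have "(\<mu> + 1 - (N + 1) / 2)\<^sup>2 \<le> N * (\<Sum>i\<le>n. (X i)\<^sup>2) - (2 * N * (\<mu> + 1) - (q + \<mu>))
        + (N\<^sup>2 - (N - 1) * N + (N - 1) * (2 * N - 1) / 6)"
      using CS unfolding SXc2 distrib_left right_diff_distrib Sc2 by simp
    then show ?thesis
      by (simp add: field_simps power2_eq_square)
  qed
  also have "\<dots> = real (n * (n + 2)) / 6"
    by (simp add: N_def power2_eq_square algebra_simps)
  finally show ?thesis .
qed

section \<open>Draws with and without replacement\<close>

lemma samp_avg: "samp n m \<alpha> (avg n x f) = (\<Sum>i\<le>n. x i * samp n m \<alpha> (\<lambda>\<gamma>. f (up i \<gamma>)))"
  unfolding avg_def by (rule samp_linear)

lemma samp_abs_le: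
  assumes "\<And>\<gamma>. \<gamma> \<in> multiidx n m \<Longrightarrow> \<bar>f \<gamma>\<bar> \<le> c"
  shows "\<bar>samp n m \<alpha> f\<bar> \<le> c * falling (\<Sum>i\<le>n. \<alpha> i) m"
proof -
  have "samp n m \<alpha> f \<le> samp n m \<alpha> (\<lambda>_. c)" "samp n m \<alpha> (\<lambda>_. - c) \<le> samp n m \<alpha> f"
    using assms by (intro samp_mono; force simp: abs_le_iff)+
  then show ?thesis by (simp add: samp_const)
qed

text \<open>Off the diagonal the number of pairs of distinct balls is \<alpha>_i \<alpha>_j, and on
  it \<open>arc_product\<close> vanishes. So the pairs may be weighted as if drawn with replacement,
  and \<open>arc_product_energy\<close> applies to \<alpha>/k; undoing that normalisation gives
  k^2.\<close>

lemma samp_defect_bound: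
  assumes \<alpha>: "\<alpha> \<in> multiidx n k" and k: "m + 2 \<le> k" and "M \<ge> 0"
    and M: "\<And>\<gamma> i j. \<gamma> \<in> multiidx n m \<Longrightarrow> i \<le> n \<Longrightarrow> j \<le> n \<Longrightarrow> \<bar>diff2 f i j \<gamma>\<bar> \<le> arc_product n i j * M"
  shows "\<bar>\<Sum>i\<le>n. \<Sum>j\<le>n. real (\<alpha> i * down i \<alpha> j) * samp n m (down j (down i \<alpha>)) (diff2 f i j)\<bar>
     \<le> real (n * (n + 2)) / 6 * (real k)\<^sup>2 * M * falling (k - 2) m"
proof -
  define F where "F = falling (k - 2) m"
  have "m \<le> k - 2" using k by simp
  then have F: "F \<ge> 0" using falling_pos[of m "k - 2"] by (simp add: F_def)
  have k0: "k > 0" using k by simp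
  have sum\<alpha>: "(\<Sum>i\<le>n. \<alpha> i) = k" using \<alpha> by (simp add: multiidx_def)
  have "\<bar>real (\<alpha> i * down i \<alpha> j) * samp n m (down j (down i \<alpha>)) (diff2 f i j)\<bar>
     \<le> real (\<alpha> i) * real (\<alpha> j) * (arc_product n i j * M * F)" if "i \<le> n" "j \<le> n" for i j
  proof (cases "\<alpha> i * down i \<alpha> j = 0")
    case True
    then show ?thesis
      unfolding True using that \<open>M \<ge> 0\<close> F by (auto intro!: mult_nonneg_nonneg arc_product_nonneg)
  next
    case False
    have "k - 2 = k - 1 - 1" by simp
    then have "(\<Sum>a\<le>n. down j (down i \<alpha>) a) = k - 2"
      using False that by (simp add: sum_down sum\<alpha>)
    then have "\<bar>samp n m (down j (down i \<alpha>)) (diff2 f i j)\<bar> \<le> arc_product n i j * M * F"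
      using samp_abs_le[of n m "diff2 f i j" "arc_product n i j * M" "down j (down i \<alpha>)"] M that by (simp add: F_def)
    then have "\<bar>real (\<alpha> i * down i \<alpha> j) * samp n m (down j (down i \<alpha>)) (diff2 f i j)\<bar>
      \<le> real (\<alpha> i * down i \<alpha> j) * (arc_product n i j * M * F)"
      by (simp add: abs_mult mult_left_mono)
    also have "\<dots> = real (\<alpha> i) * real (\<alpha> j) * (arc_product n i j * M * F)"
      by (cases "i = j") (auto simp: down_apply)
    finally show ?thesis .
  qed
  then have "\<bar>\<Sum>i\<le>n. \<Sum>j\<le>n. real (\<alpha> i * down i \<alpha> j) * samp n m (down j (down i \<alpha>)) (diff2 f i j)\<bar>
     \<le> (\<Sum>i\<le>n. \<Sum>j\<le>n. real (\<alpha> i) * real (\<alpha> j) * (arc_product n i j * M * F))"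
    by (intro order_trans[OF sum_abs] sum_mono order_trans[OF sum_abs]) simp
  also have "\<dots> = (\<Sum>i\<le>n. \<Sum>j\<le>n. real (\<alpha> i) / real k * (real (\<alpha> j) / real k) * arc_product n i j) * ((real k)\<^sup>2 * M * F)"
    unfolding sum_distrib_right
    by (intro sum.cong refl) (use k0 in \<open>simp add: power2_eq_square field_simps\<close>)
  also have "\<dots> \<le> real (n * (n + 2)) / 6 * ((real k)\<^sup>2 * M * F)"
    using k0 \<open>M \<ge> 0\<close> F sum\<alpha>
    by (intro mult_right_mono arc_product_energy) (auto simp: sum_divide_distrib[symmetric] simp flip: of_nat_sum)
  finally show ?thesis by (simp add: F_def mult_ac)
qed

text \<open>Draws without and with replacement from \<open>\<alpha>\<close> are interpolated by making only the first \<open>m\<close> of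
  the \<open>l\<close> draws without replacement.\<close>

lemma avg_pow_samp_bound:
  assumes \<alpha>: "\<alpha> \<in> multiidx n k" and k: "l < k" and "M \<ge> 0"
    and M: "\<And>\<gamma> i j. l \<ge> 2 \<Longrightarrow> \<gamma> \<in> multiidx n (l - 2) \<Longrightarrow> i < j \<Longrightarrow> j \<le> n \<Longrightarrow> \<bar>nabla2 n b \<gamma> i j\<bar> \<le> M"
  shows "\<bar>(avg n (\<lambda>i. real (\<alpha> i) / real k) ^^ l) b (\<lambda>_. 0) - samp n l \<alpha> b / falling k l\<bar>
     \<le> real (n * (n + 2) * l * (l - 1)) / 24 * M / (real k - 1)"
proof -
  define x where "x i = real (\<alpha> i) / real k" for i
  have k0: "k > 0" using k by simp
  have sum\<alpha>: "(\<Sum>i\<le>n. \<alpha> i) = k" using \<alpha> by (simp add: multiidx_def)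
  have x0: "x i \<ge> 0" for i by (simp add: x_def)
  have x1: "(\<Sum>i\<le>n. x i) = 1"
    using k0 sum\<alpha> by (simp add: x_def sum_divide_distrib[symmetric] flip: of_nat_sum)
  \<comment> \<open>\<open>W 0\<close> is the mean with replacement throughout, \<open>W l\<close>
    the mean without.\<close>
  define W where "W m = samp n m \<alpha> ((avg n x ^^ (l - m)) b) / falling k m" for m
  define C where "C = real (n * (n + 2)) / 12 * M / (real k - 1)"
  have step: "\<bar>W m - W (Suc m)\<bar> \<le> real m * C" if m: "m < l" for m
  proof -
    define f where "f = (avg n x ^^ (l - Suc m)) b"
    have "l - m = Suc (l - Suc m)" using m by simp
    then have Wm: "W m = (\<Sum>i\<le>n. real (\<alpha> i) * samp n m \<alpha> (\<lambda>\<gamma>. f (up i \<gamma>))) / (real k * falling k m)"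
      by (simp add: W_def f_def samp_avg x_def sum_divide_distrib)
    have Wm1: "W (Suc m) = samp n (Suc m) \<alpha> f / falling k (Suc m)"
      by (simp add: W_def f_def)
    show ?thesis
    proof (cases m)
      \<comment> \<open>The first draw meets the full urn in both schemes, so the two means
        agree.\<close>
      case 0
      have "samp n (Suc 0) \<alpha> f = (\<Sum>i\<le>n. real (\<alpha> i) * samp n 0 \<alpha> (\<lambda>\<gamma>. f (up i \<gamma>)))" by simp
      then show ?thesis using Wm Wm1 0 by (simp add: falling_Suc)
    next
      case (Suc m')
      define D where "D = (\<Sum>i\<le>n. \<Sum>j\<le>n. real (\<alpha> i * down i \<alpha> j) * samp n m' (down j (down i \<alpha>)) (diff2 f i j))"
      define S where "S = (\<Sum>i\<le>n. real (\<alpha> i) * samp n m \<alpha> (\<lambda>\<gamma>. f (up i \<gamma>)))"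
      have eq: "(real k - real m) * S = real k * samp n (Suc m) \<alpha> f + real m / 2 * D"
        unfolding S_def D_def Suc using samp_step[where n = n and \<alpha> = \<alpha> and m = m' and f = f] by (simp only: sum\<alpha>)
      have F: "falling k (Suc m) = (real k - real m) * falling k m" "falling k m > 0" "real k - real m > 0"
        using m k by (auto simp: falling_Suc intro: falling_pos)
      have Wdiff: "W m - W (Suc m) = real m / 2 * D / (real k * falling k (Suc m))"
      proof -
        have "W m = (real k - real m) * S / (real k * falling k (Suc m))"
          unfolding Wm S_def[symmetric] using F k0 by simp
        moreover have "W (Suc m) = real k * samp n (Suc m) \<alpha> f / (real k * falling k (Suc m))"
          unfolding Wm1 using k0 by simp
        ultimately show ?thesis unfolding eq by (simp add: add_divide_distrib)
      qed
      \<comment> \<open>This form lets \<open>falling_Suc_Suc\<close> split off the two factors k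
        and k - 1.\<close>
      have k2: "k = Suc (Suc (k - 2))" using k m Suc by simp
      have F2: "falling k (Suc m) = real k * (real k - 1) * falling (k - 2) m'" "falling (k - 2) m' > 0" "real k > 1"
      proof -
        have "falling (Suc (Suc (k - 2))) (Suc (Suc m')) = real (Suc (Suc (k - 2))) * (real (Suc (k - 2)) * falling (k - 2) m')"
          by (simp only: falling_Suc_Suc)
        moreover have "real (Suc (k - 2)) = real k - 1" using k m Suc by (simp add: of_nat_diff)
        ultimately show "falling k (Suc m) = real k * (real k - 1) * falling (k - 2) m'"
          unfolding Suc k2[symmetric] by simp
        show "falling (k - 2) m' > 0" using k m Suc by (intro falling_pos) simp
        show "real k > 1" using k m Suc by simp
      qed
      have "\<bar>D\<bar> \<le> real (n * (n + 2)) / 6 * (real k)\<^sup>2 * M * falling (k - 2) m'"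
        unfolding D_def
      proof (rule samp_defect_bound[OF \<alpha> _ \<open>M \<ge> 0\<close>])
        show "m' + 2 \<le> k" using k m Suc by simp
        fix \<gamma> i j assume "\<gamma> \<in> multiidx n m'" "i \<le> n" "j \<le> n"
        \<comment> \<open>Second differences of \<open>b\<close> live in degree
          \<open>l - 2\<close>; the \<open>l - Suc m\<close> averagings bring them down to degree
          \<open>m'\<close>.\<close>
        moreover have "l - 2 = m' + (l - Suc m)" "l \<ge> 2" using m Suc by simp_all
        ultimately show "\<bar>diff2 f i j \<gamma>\<bar> \<le> arc_product n i j * M"
          unfolding f_def avg_pow_diff2 using M x0 x1
          by (intro avg_pow_bound[of n x m'] diff2_bound) auto
      qed
      then have "\<bar>W m - W (Suc m)\<bar> \<le> real m / 2 * (real (n * (n + 2)) / 6 * (real k)\<^sup>2 * M * falling (k - 2) m') / (real k * falling k (Suc m))"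
      proof -
        have "\<bar>W m - W (Suc m)\<bar> = real m / 2 * \<bar>D\<bar> / (real k * falling k (Suc m))"
          unfolding Wdiff using F by (simp add: abs_mult)
        also have "\<dots> \<le> real m / 2 * (real (n * (n + 2)) / 6 * (real k)\<^sup>2 * M * falling (k - 2) m') / (real k * falling k (Suc m))"
          by (intro divide_right_mono mult_left_mono \<open>\<bar>D\<bar> \<le> _\<close>) (use F in auto)
        finally show ?thesis .
      qed
      \<comment> \<open>Of the factors k, k and k - 1 below, the k^2 above cancels the first two;
        this is the source of 1/(k - 1).\<close>
      also have "\<dots> = real m * C"
        unfolding F2(1) using F2(2,3) k0 by (simp add: C_def power2_eq_square field_simps)
      finally show ?thesis .
    qed
  qed
  have "\<bar>W 0 - W l\<bar> = \<bar>\<Sum>m<l. W m - W (Suc m)\<bar>"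
    by (simp add: sum_lessThan_telescope')
  also have "\<dots> \<le> (\<Sum>m<l. real m * C)"
    by (intro order_trans[OF sum_abs] sum_mono step) simp
  also have "\<dots> = real (l * (l - 1)) / 2 * C"
  proof -
    have "(\<Sum>m<l. real m) = real (l * (l - 1)) / 2"
    proof (induction l)
      case (Suc l)
      then show ?case by (cases l) (auto simp: field_simps)
    qed simp
    then show ?thesis by (simp add: sum_distrib_right[symmetric])
  qed
  also have "\<dots> = real (n * (n + 2) * l * (l - 1)) / 24 * M / (real k - 1)"
    by (simp add: C_def)
  finally show ?thesis by (simp add: W_def x_def[abs_def])
qed

section \<open>The Bernstein basis\<close>

lemma sum_bary: "(\<Sum>i\<le>n. bary n x i) = 1"
proof -
  have "{..n} = insert 0 {1..n}" by auto
  then show ?thesis by (simp add: bary_def)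
qed

lemma bernstein_up:
  assumes "i \<le> n"
  shows "bary n x i * bernstein n k \<alpha> x = real (Suc (\<alpha> i)) / real (Suc k) * bernstein n (Suc k) (up i \<alpha>) x"
proof -
  have "(\<Prod>j\<le>n. fact (up i \<alpha> j)) = real (Suc (\<alpha> i)) * (\<Prod>j\<le>n. fact (\<alpha> j))"
    using assms by (simp add: prod.remove[of "{..n}" i] up_apply)
  moreover have "(\<Prod>j\<le>n. bary n x j ^ up i \<alpha> j) = bary n x i * (\<Prod>j\<le>n. bary n x j ^ \<alpha> j)"
    using assms by (simp add: prod.remove[of "{..n}" i] up_apply)
  ultimately show ?thesis
    by (simp add: bernstein_def divide_simps del: of_nat_Suc)
qed

lemma bernstein_up_scaled:
  "i \<le> n \<Longrightarrow> bary n x i * (c * bernstein n k \<alpha> x)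
    = real (up i \<alpha> i) / real (Suc k) * c * bernstein n (Suc k) (up i \<alpha>) x"
  by (simp only: mult.left_commute[of _ c] bernstein_up up_apply) simp

text \<open>For fixed \<open>i\<close>, \<open>up i\<close> is a bijection onto the indices with
  positive \<open>i\<close>-th entry; the guard excludes the others.\<close>

lemma sum_multiidx_up:
  fixes h :: "nat \<Rightarrow> (nat \<Rightarrow> nat) \<Rightarrow> real"
  shows "(\<Sum>i\<le>n. \<Sum>\<alpha>\<in>multiidx n k. h i (up i \<alpha>))
       = (\<Sum>\<beta>\<in>multiidx n (Suc k). \<Sum>i\<le>n. if \<beta> i = 0 then 0 else h i \<beta>)"
proof -
  have "(\<Sum>\<alpha>\<in>multiidx n k. h i (up i \<alpha>)) = (\<Sum>\<beta>\<in>multiidx n (Suc k). if \<beta> i = 0 then 0 else h i \<beta>)"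
    if "i \<le> n" for i
  proof -
    have "(\<Sum>\<beta>\<in>multiidx n (Suc k). if \<beta> i = 0 then 0 else h i \<beta>)
        = (\<Sum>\<beta>\<in>{\<beta>\<in>multiidx n (Suc k). \<beta> i > 0}. h i \<beta>)"
      by (intro sum.mono_neutral_cong_right) auto
    also have "\<dots> = (\<Sum>\<alpha>\<in>multiidx n k. h i (up i \<alpha>))"
      by (rule sum.reindex_bij_witness[of _ "up i" "down i"])
        (use that in \<open>auto simp: up_down intro: up_multiidx down_multiidx, auto simp: up_apply\<close>)
    finally show ?thesis ..
  qed
  then have "(\<Sum>i\<le>n. \<Sum>\<alpha>\<in>multiidx n k. h i (up i \<alpha>))
      = (\<Sum>i\<le>n. \<Sum>\<beta>\<in>multiidx n (Suc k). if \<beta> i = 0 then 0 else h i \<beta>)"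
    by (intro sum.cong[OF refl]) simp
  also have "\<dots> = (\<Sum>\<beta>\<in>multiidx n (Suc k). \<Sum>i\<le>n. if \<beta> i = 0 then 0 else h i \<beta>)"
    by (rule sum.swap)
  finally show ?thesis .
qed

text \<open>Multiply by the sum of the barycentric coordinates, which is 1, and collect: the new
  coefficient is the mean over the removal of one ball.\<close>

lemma bernstein_elevate:
  "(\<Sum>\<alpha>\<in>multiidx n k. b \<alpha> * bernstein n k \<alpha> x)
   = (\<Sum>\<beta>\<in>multiidx n (Suc k). ((\<Sum>i\<le>n. real (\<beta> i) * b (down i \<beta>)) / real (Suc k)) * bernstein n (Suc k) \<beta> x)"
proof -
  have "(\<Sum>\<alpha>\<in>multiidx n k. b \<alpha> * bernstein n k \<alpha> x)
      = (\<Sum>i\<le>n. \<Sum>\<alpha>\<in>multiidx n k. bary n x i * (b \<alpha> * bernstein n k \<alpha> x))"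
    using sum_bary[of n x] by (simp flip: sum_distrib_left sum_distrib_right)
  also have "\<dots> = (\<Sum>i\<le>n. \<Sum>\<alpha>\<in>multiidx n k. real (up i \<alpha> i) / real (Suc k) * b (down i (up i \<alpha>)) * bernstein n (Suc k) (up i \<alpha>) x)"
    by (intro sum.cong refl) (simp only: bernstein_up_scaled down_up atMost_iff)
  also have "\<dots> = (\<Sum>\<beta>\<in>multiidx n (Suc k). \<Sum>i\<le>n. if \<beta> i = 0 then 0 else real (\<beta> i) / real (Suc k) * b (down i \<beta>) * bernstein n (Suc k) \<beta> x)"
    by (rule sum_multiidx_up)
  also have "\<dots> = (\<Sum>\<beta>\<in>multiidx n (Suc k). \<Sum>i\<le>n. real (\<beta> i) * b (down i \<beta>) / real (Suc k) * bernstein n (Suc k) \<beta> x)"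
    by (intro sum.cong refl) auto
  finally show ?thesis by (simp only: sum_divide_distrib sum_distrib_right)
qed

text \<open>The de Casteljau algorithm. After one more draw the index \<beta> collects the weights
  \<beta>_i / (k + 1), whose sum over \<open>i\<close> is 1.\<close>

lemma bernstein_eval:
  "(\<Sum>\<alpha>\<in>multiidx n k. b \<alpha> * bernstein n k \<alpha> x) = (avg n (bary n x) ^^ k) b (\<lambda>_. 0)"
proof (induction k arbitrary: b)
  case 0
  then show ?case by (simp add: multiidx_0 bernstein_def)
next
  case (Suc k)
  have "(avg n (bary n x) ^^ Suc k) b (\<lambda>_. 0) = (\<Sum>i\<le>n. bary n x i * (avg n (bary n x) ^^ k) b (up i (\<lambda>_. 0)))"
    by (simp add: avg_def)
  also have "\<dots> = (\<Sum>i\<le>n. bary n x i * (\<Sum>\<alpha>\<in>multiidx n k. b (up i \<alpha>) * bernstein n k \<alpha> x))"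
    by (simp add: Suc avg_pow_commute_up)
  also have "\<dots> = (\<Sum>i\<le>n. \<Sum>\<alpha>\<in>multiidx n k. real (up i \<alpha> i) / real (Suc k) * b (up i \<alpha>) * bernstein n (Suc k) (up i \<alpha>) x)"
    unfolding sum_distrib_left
    by (intro sum.cong refl) (simp only: bernstein_up_scaled atMost_iff)
  also have "\<dots> = (\<Sum>\<beta>\<in>multiidx n (Suc k). \<Sum>i\<le>n. if \<beta> i = 0 then 0 else real (\<beta> i) / real (Suc k) * b \<beta> * bernstein n (Suc k) \<beta> x)"
    by (rule sum_multiidx_up)
  also have "\<dots> = (\<Sum>\<beta>\<in>multiidx n (Suc k). \<Sum>i\<le>n. real (\<beta> i) * (b \<beta> * bernstein n (Suc k) \<beta> x / real (Suc k)))"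
    by (intro sum.cong refl) auto
  also have "\<dots> = (\<Sum>\<beta>\<in>multiidx n (Suc k). b \<beta> * bernstein n (Suc k) \<beta> x)"
    unfolding sum_distrib_right[symmetric]
    by (intro sum.cong refl) (auto simp: multiidx_def simp del: of_nat_Suc simp flip: of_nat_sum)
  finally show ?case ..
qed

lemma sum_bernstein: "(\<Sum>\<alpha>\<in>multiidx n k. bernstein n k \<alpha> x) = 1"
proof -
  have "(avg n (bary n x) ^^ r) (\<lambda>_. 1) = (\<lambda>_. 1)" for r
    by (induction r) (simp_all add: avg_def sum_bary)
  then show ?thesis using bernstein_eval[where b = "\<lambda>_. 1"] by simp
qed

section \<open>Linear independence of the Bernstein polynomials, by uniqueness of base K
  digits\<close>

lemma digits_inj:
  fixes a b :: "nat \<Rightarrow> nat"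
  assumes "(\<Sum>i\<le>n. a i * K ^ i) = (\<Sum>i\<le>n. b i * K ^ i)"
    and "\<And>i. a i < K" "\<And>i. b i < K" "j \<le> n"
  shows "a j = b j"
  using assms
proof (induction n arbitrary: a b j)
  case (Suc n)
  have *: "(\<Sum>i\<le>Suc n. c i * K ^ i) = c 0 + K * (\<Sum>i\<le>n. c (Suc i) * K ^ i)" for c
    unfolding sum.atMost_Suc_shift sum_distrib_left by (simp add: mult_ac)
  have eq: "a 0 + K * (\<Sum>i\<le>n. a (Suc i) * K ^ i) = b 0 + K * (\<Sum>i\<le>n. b (Suc i) * K ^ i)"
    using Suc.prems(1) unfolding * .
  have a0: "a 0 = b 0"
    using arg_cong[OF eq, of "\<lambda>t. t mod K"] Suc.prems(2,3) by simp
  moreover have "K > 0" using Suc.prems(2)[of 0] by simp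
  ultimately have "(\<Sum>i\<le>n. a (Suc i) * K ^ i) = (\<Sum>i\<le>n. b (Suc i) * K ^ i)"
    using eq by simp
  then have "a (Suc i) = b (Suc i)" if "i \<le> n" for i
    using Suc.IH[of "\<lambda>i. a (Suc i)" "\<lambda>i. b (Suc i)"] Suc.prems(2,3) that by simp
  then show ?case using a0 Suc.prems(4) by (cases j) auto
qed simp

text \<open>Kronecker substitution: at \<open>\<lambda>\<^sub>i \<propto> t ^ (k + 1) ^ i\<close> the Bernstein polynomials become
  monomials in \<open>t\<close> of distinct degrees, up to a common factor.\<close>

lemma bernstein_independent:
  assumes "\<And>x. (\<Sum>\<alpha>\<in>multiidx n k. d \<alpha> * bernstein n k \<alpha> x) = 0" and \<alpha>: "\<alpha> \<in> multiidx n k"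
  shows "d \<alpha> = 0"
proof -
  \<comment> \<open>The base exceeds every entry of a multi-index of degree \<open>k\<close>, so the
    entries are digits.\<close>
  define K where "K = Suc k"
  define c :: "(nat \<Rightarrow> nat) \<Rightarrow> real" where "c \<alpha> = fact k / (\<Prod>i\<le>n. fact (\<alpha> i))" for \<alpha>
  define e where "e \<alpha> = (\<Sum>i\<le>n. \<alpha> i * K ^ i)" for \<alpha> :: "nat \<Rightarrow> nat"
  define P where "P = (\<Sum>\<alpha>\<in>multiidx n k. monom (d \<alpha> * c \<alpha>) (e \<alpha>))"
  have zero: "poly P t = 0" if "t > 0" for t
  proof -
    \<comment> \<open>Dividing by \<open>S\<close> makes the coordinates sum to 1; the zeroth one is
      t / S because K^0 = 1.\<close>
    define S where "S = (\<Sum>i\<le>n. t ^ K ^ i)"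
    have S: "S > 0" unfolding S_def using that by (intro sum_pos) auto
    define x where "x i = t ^ K ^ i / S" for i
    have "bary n x i = t ^ K ^ i / S" if "i \<le> n" for i
    proof (cases i)
      case 0
      have "{..n} = insert 0 {1..n}" by auto
      then have "S = t + (\<Sum>i=1..n. t ^ K ^ i)" by (simp add: S_def)
      then show ?thesis using 0 S by (simp add: bary_def x_def sum_divide_distrib[symmetric] field_simps)
    qed (simp add: bary_def x_def)
    then have pr: "(\<Prod>i\<le>n. bary n x i ^ \<alpha> i) = (\<Prod>i\<le>n. t ^ (\<alpha> i * K ^ i) / S ^ \<alpha> i)" for \<alpha>
      by (intro prod.cong[OF refl]) (simp add: power_divide mult.commute flip: power_mult)
    have "bernstein n k \<alpha> x = c \<alpha> * t ^ e \<alpha> / S ^ k" if "\<alpha> \<in> multiidx n k" for \<alpha>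
      unfolding bernstein_def pr prod_dividef power_sum[symmetric] c_def e_def
      using that by (simp add: multiidx_def)
    then have "0 = (\<Sum>\<alpha>\<in>multiidx n k. d \<alpha> * (c \<alpha> * t ^ e \<alpha> / S ^ k))"
      using assms(1)[of x] by simp
    also have "\<dots> = poly P t / S ^ k"
      by (simp add: P_def poly_sum poly_monom sum_divide_distrib mult_ac)
    finally show ?thesis using S by simp
  qed
  have "P = 0"
  proof (rule ccontr)
    assume "P \<noteq> 0"
    then have "finite {t. poly P t = 0}" by (rule poly_roots_finite)
    then have "finite {0::real<..}" by (rule rev_finite_subset) (use zero in auto)
    then show False by (simp add: infinite_Ioi)
  qed
  have inj: "\<alpha>' = \<alpha>" if "\<alpha>' \<in> multiidx n k" "e \<alpha>' = e \<alpha>" for \<alpha>'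
  proof
    fix i
    show "\<alpha>' i = \<alpha> i"
    proof (cases "i \<le> n")
      case True
      show ?thesis
        by (rule digits_inj[where a = \<alpha>' and b = \<alpha> and K = K and n = n])
          (use that \<alpha> True multiidx_le in \<open>auto simp: e_def K_def less_Suc_eq_le\<close>)
    qed (use that \<alpha> in \<open>auto simp: multiidx_def\<close>)
  qed
  have "coeff P (e \<alpha>) = (\<Sum>\<alpha>'\<in>multiidx n k. if \<alpha>' = \<alpha> then d \<alpha>' * c \<alpha>' else 0)"
    unfolding P_def coeff_sum
  proof (intro sum.cong[OF refl])
    fix \<alpha>' assume "\<alpha>' \<in> multiidx n k"
    then have "e \<alpha>' = e \<alpha> \<longleftrightarrow> \<alpha>' = \<alpha>" using inj by blast
    then show "coeff (monom (d \<alpha>' * c \<alpha>') (e \<alpha>')) (e \<alpha>) = (if \<alpha>' = \<alpha> then d \<alpha>' * c \<alpha>' else 0)" by simp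
  qed
  then have "d \<alpha> * c \<alpha> = 0" using \<alpha> \<open>P = 0\<close> by simp
  moreover have "c \<alpha> > 0" by (auto simp: c_def intro!: divide_pos_pos prod_pos)
  ultimately show ?thesis by simp
qed

section \<open>Bernstein coefficients and repeated degree elevation\<close>

lemma bcoef_eqI:
  assumes "\<And>x. p x = (\<Sum>\<alpha>\<in>multiidx n k. b \<alpha> * bernstein n k \<alpha> x)" and "\<alpha> \<in> multiidx n k"
  shows "bcoef n k p \<alpha> = b \<alpha>"
proof -
  \<comment> \<open>The description in \<open>bcoef\<close> fixes the value 0 off the index set, so
    \<open>b\<close> is cut off there.\<close>
  define b' where "b' \<alpha> = (if \<alpha> \<in> multiidx n k then b \<alpha> else 0)" for \<alpha>
  have b': "p x = (\<Sum>\<alpha>\<in>multiidx n k. b' \<alpha> * bernstein n k \<alpha> x)" for x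
    using assms(1) by (simp add: b'_def)
  have "bcoef n k p = b'"
    unfolding bcoef_def
  proof (rule the_equality)
    fix g assume g: "(\<forall>\<alpha>. \<alpha> \<notin> multiidx n k \<longrightarrow> g \<alpha> = 0) \<and>
      (\<forall>x. p x = (\<Sum>\<alpha>\<in>multiidx n k. g \<alpha> * bernstein n k \<alpha> x))"
    have "g \<alpha> - b' \<alpha> = 0" if "\<alpha> \<in> multiidx n k" for \<alpha>
    proof (rule bernstein_independent[OF _ that])
      fix x
      show "(\<Sum>\<alpha>\<in>multiidx n k. (g \<alpha> - b' \<alpha>) * bernstein n k \<alpha> x) = 0"
        using g b'[of x] by (simp add: left_diff_distrib sum_subtractf)
    qed
    then show "g = b'" using g by (force simp: b'_def fun_eq_iff)
  qed (use b' in \<open>auto simp: b'_def\<close>)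
  then show ?thesis using assms(2) by (simp add: b'_def)
qed

text \<open>Representability in degree \<open>k\<close> survives linear combination and degree
  elevation, whereas \<open>poly_of_degree\<close> prescribes the exact degree.\<close>

definition bform :: "nat \<Rightarrow> nat \<Rightarrow> ((nat \<Rightarrow> real) \<Rightarrow> real) \<Rightarrow> bool" where
  "bform n k p \<longleftrightarrow> (\<exists>b. \<forall>x. p x = (\<Sum>\<alpha>\<in>multiidx n k. b \<alpha> * bernstein n k \<alpha> x))"

lemma bform_bcoef:
  assumes "bform n k p"
  shows "p x = (\<Sum>\<alpha>\<in>multiidx n k. bcoef n k p \<alpha> * bernstein n k \<alpha> x)"
proof -
  obtain b where b: "\<And>x. p x = (\<Sum>\<alpha>\<in>multiidx n k. b \<alpha> * bernstein n k \<alpha> x)"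
    using assms unfolding bform_def by blast
  show ?thesis unfolding b[of x] by (intro sum.cong refl) (simp add: bcoef_eqI[where b = b, OF b])
qed

lemma bform_Suc: "bform n k p \<Longrightarrow> bform n (Suc k) p"
proof -
  assume "bform n k p"
  then obtain b where "\<And>x. p x = (\<Sum>\<alpha>\<in>multiidx n k. b \<alpha> * bernstein n k \<alpha> x)"
    unfolding bform_def by blast
  then have "\<And>x. p x = (\<Sum>\<beta>\<in>multiidx n (Suc k). ((\<Sum>i\<le>n. real (\<beta> i) * b (down i \<beta>)) / real (Suc k)) * bernstein n (Suc k) \<beta> x)"
    by (simp only: bernstein_elevate[where k = k])
  then show ?thesis unfolding bform_def by (intro exI allI)
qed

lemma bform_mono: "k \<le> m \<Longrightarrow> bform n k p \<Longrightarrow> bform n m p"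
  by (induction m rule: dec_induct) (auto intro: bform_Suc)

lemma bform_sum:
  assumes "\<And>\<beta>. \<beta> \<in> I \<Longrightarrow> bform n k (f \<beta>)"
  shows "bform n k (\<lambda>x. \<Sum>\<beta>\<in>I. c \<beta> * f \<beta> x)"
proof -
  have "(\<Sum>\<beta>\<in>I. c \<beta> * f \<beta> x)
      = (\<Sum>\<alpha>\<in>multiidx n k. (\<Sum>\<beta>\<in>I. c \<beta> * bcoef n k (f \<beta>) \<alpha>) * bernstein n k \<alpha> x)" for x
  proof -
    have "(\<Sum>\<beta>\<in>I. c \<beta> * f \<beta> x) = (\<Sum>\<beta>\<in>I. \<Sum>\<alpha>\<in>multiidx n k. c \<beta> * bcoef n k (f \<beta>) \<alpha> * bernstein n k \<alpha> x)"
      by (intro sum.cong refl) (simp add: bform_bcoef[OF assms] sum_distrib_left mult.assoc)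
    also have "\<dots> = (\<Sum>\<alpha>\<in>multiidx n k. \<Sum>\<beta>\<in>I. c \<beta> * bcoef n k (f \<beta>) \<alpha> * bernstein n k \<alpha> x)"
      by (rule sum.swap)
    finally show ?thesis by (simp only: sum_distrib_right)
  qed
  then show ?thesis unfolding bform_def by (intro exI allI)
qed

lemma bform_mon_eval:
  assumes "\<beta> \<in> mono_exps n l"
  shows "bform n l (mon_eval n \<beta>)"
proof -
  define m where "m = (\<Sum>i=1..n. \<beta> i)"
  have eq: "{..n} = insert 0 {1..n}" by auto
  have \<beta>0: "\<beta> 0 = 0" using assms by (auto simp: mono_exps_def)
  have \<beta>: "\<beta> \<in> multiidx n m" using assms by (auto simp: mono_exps_def multiidx_def m_def eq)
  \<comment> \<open>Since \<beta>_0 = 0, the monomial is a multiple of one Bernstein polynomial of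
    its own degree \<open>m\<close>; \<open>c\<close> undoes the multinomial coefficient.\<close>
  define c :: real where "c = (\<Prod>i\<le>n. fact (\<beta> i)) / fact m"
  have "(\<Prod>i\<le>n. fact (\<beta> i)) > (0::real)" by (intro prod_pos) auto
  then have "c * bernstein n m \<beta> x = (\<Prod>i\<le>n. bary n x i ^ \<beta> i)" for x
    by (simp add: c_def bernstein_def)
  also have "(\<Prod>i\<le>n. bary n x i ^ \<beta> i) = mon_eval n \<beta> x" for x
    unfolding mon_eval_def eq by (simp add: \<beta>0 bary_def)
  finally have "mon_eval n \<beta> x = c * bernstein n m \<beta> x" for x by simp
  then have "mon_eval n \<beta> x = (\<Sum>\<alpha>\<in>multiidx n m. (if \<alpha> = \<beta> then c else 0) * bernstein n m \<alpha> x)" for x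
    using \<beta> by (simp add: if_distrib[of "\<lambda>t. t * _"] cong: if_cong)
  then have "bform n m (mon_eval n \<beta>)" unfolding bform_def by (intro exI allI)
  then show ?thesis by (rule bform_mono[rotated]) (use assms in \<open>simp add: m_def mono_exps_def\<close>)
qed

lemma poly_of_degree_bform:
  assumes "poly_of_degree n l p"
  shows "bform n l p"
proof -
  obtain c where "p = (\<lambda>x. \<Sum>\<beta>\<in>mono_exps n l. c \<beta> * mon_eval n \<beta> x)"
    using assms unfolding poly_of_degree_def by blast
  then show ?thesis by (simp only: bform_sum bform_mon_eval)
qed

text \<open>Emptying the urn always yields \<alpha> itself, in m! orders.\<close>

lemma samp_full: "\<alpha> \<in> multiidx n m \<Longrightarrow> samp n m \<alpha> f = falling m m * f \<alpha>"
proof (induction m arbitrary: \<alpha> f)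
  case (Suc m)
  have "real (\<alpha> i) * samp n m (down i \<alpha>) (\<lambda>\<gamma>. f (up i \<gamma>)) = real (\<alpha> i) * (falling m m * f \<alpha>)" if "i \<le> n" for i
    using Suc that by (cases "\<alpha> i = 0") (auto simp: down_multiidx up_down)
  then have "samp n (Suc m) \<alpha> f = (\<Sum>i\<le>n. real (\<alpha> i) * (falling m m * f \<alpha>))"
    unfolding samp.simps by (intro sum.cong[OF refl]) (simp only: atMost_iff)
  also have "\<dots> = real (\<Sum>i\<le>n. \<alpha> i) * (falling m m * f \<alpha>)"
    by (simp add: sum_distrib_right)
  finally have "samp n (Suc m) \<alpha> f = real (\<Sum>i\<le>n. \<alpha> i) * (falling m m * f \<alpha>)" .
  then show ?case using Suc.prems by (simp add: multiidx_def falling_Suc_Suc del: of_nat_sum)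
qed (simp add: multiidx_0)

text \<open>Induction on \<open>k\<close>: one elevation averages over a removed ball, and
  \<open>samp_remove\<close> turns this back into draws from the full urn.\<close>

lemma bcoef_elevate:
  assumes p: "bform n l p" and "l \<le> k" and \<alpha>: "\<alpha> \<in> multiidx n k"
  shows "bcoef n k p \<alpha> = samp n l \<alpha> (bcoef n l p) / falling k l"
proof (rule bcoef_eqI[OF _ \<alpha>])
  fix x
  show "p x = (\<Sum>\<alpha>\<in>multiidx n k. samp n l \<alpha> (bcoef n l p) / falling k l * bernstein n k \<alpha> x)"
    using \<open>l \<le> k\<close>
  proof (induction k rule: dec_induct)
    case base
    show ?case
      using bform_bcoef[OF p, of x] falling_pos[of l l] by (simp add: samp_full)
  next
    case (step k)
    \<comment> \<open>Both sides are \<open>falling (Suc k) (Suc l)\<close>, with the last or the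
      first factor split off.\<close>
    have "falling (Suc k) l * (real (Suc k) - real l) = real (Suc k) * falling k l"
      using falling_Suc[of "Suc k" l] falling_Suc_Suc[of k l] by (simp add: mult.commute)
    moreover have "real (Suc k) - real l > 0" using step by simp
    ultimately have *: "(real (Suc k) - real l) * s / (real (Suc k) * falling k l) = s / falling (Suc k) l" for s
      by (simp flip: \<open>_ = real (Suc k) * falling k l\<close> del: of_nat_Suc)
    have "(\<Sum>i\<le>n. real (\<beta> i) * (samp n l (down i \<beta>) (bcoef n l p) / falling k l)) / real (Suc k)
        = samp n l \<beta> (bcoef n l p) / falling (Suc k) l" if "\<beta> \<in> multiidx n (Suc k)" for \<beta>
    proof -
      have "(\<Sum>i\<le>n. real (\<beta> i) * (samp n l (down i \<beta>) (bcoef n l p) / falling k l))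
          = (real (\<Sum>i\<le>n. \<beta> i) - real l) * samp n l \<beta> (bcoef n l p) / falling k l"
        unfolding samp_remove[symmetric] by (simp add: sum_divide_distrib)
      then show ?thesis using that *[symmetric] by (simp add: multiidx_def mult.commute del: of_nat_sum of_nat_Suc)
    qed
    then show ?case
      by (intro trans[OF trans[OF step.IH bernstein_elevate] sum.cong[OF refl]]) simp
  qed
qed

section \<open>Rational functions\<close>

lemma bary_nonneg: "x \<in> std_simplex n \<Longrightarrow> i \<le> n \<Longrightarrow> bary n x i \<ge> 0"
  by (auto simp: std_simplex_def bary_def)

lemma bernstein_nonneg: "x \<in> std_simplex n \<Longrightarrow> bernstein n k \<alpha> x \<ge> 0"
  by (auto simp: bernstein_def intro!: mult_nonneg_nonneg divide_nonneg_nonneg prod_nonneg zero_le_power bary_nonneg)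

text \<open>The grid point \<alpha>/k, with \<alpha>_0 recovered by \<open>bary\<close>; the value 0
  elsewhere is what \<open>std_simplex\<close> demands.\<close>

definition node :: "nat \<Rightarrow> nat \<Rightarrow> (nat \<Rightarrow> nat) \<Rightarrow> nat \<Rightarrow> real" where
  "node n k \<alpha> i = (if i \<in> {1..n} then real (\<alpha> i) / real k else 0)"

lemma bary_node:
  assumes "\<alpha> \<in> multiidx n k" "k > 0" "i \<le> n"
  shows "bary n (node n k \<alpha>) i = real (\<alpha> i) / real k"
proof -
  have "{..n} = insert 0 {1..n}" by auto
  then have "(\<Sum>i=1..n. real (\<alpha> i)) = real k - real (\<alpha> 0)"
    using assms(1) by (auto simp: multiidx_def simp flip: of_nat_sum)
  then have "(\<Sum>i=1..n. node n k \<alpha> i) = (real k - real (\<alpha> 0)) / real k"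
    by (simp add: node_def flip: sum_divide_distrib)
  then show ?thesis
    using assms(2,3) by (simp add: bary_def diff_divide_distrib) (simp add: node_def)
qed

lemma node_in_simplex:
  assumes "\<alpha> \<in> multiidx n k" "k > 0"
  shows "node n k \<alpha> \<in> std_simplex n"
proof -
  have "bary n (node n k \<alpha>) 0 \<ge> 0" using bary_node[OF assms, of 0] by simp
  then show ?thesis by (auto simp: std_simplex_def bary_def node_def)
qed

section \<open>The error at the nodes\<close>

lemma nabla2_norm_bound:
  assumes "l \<ge> 2" "\<gamma> \<in> multiidx n (l - 2)" "i < j" "j \<le> n"
  shows "\<bar>nabla2 n (bcoef n l p) \<gamma> i j\<bar> \<le> nabla2_norm n l p"
proof -
  let ?A = "{\<bar>nabla2 n (bcoef n l p) \<gamma> i j\<bar> | \<gamma> i j. \<gamma> \<in> multiidx n (l - 2) \<and> i < j \<and> j \<le> n}"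
  have "?A \<subseteq> (\<lambda>(\<gamma>, i, j). \<bar>nabla2 n (bcoef n l p) \<gamma> i j\<bar>) ` (multiidx n (l - 2) \<times> {..n} \<times> {..n})"
    by force
  then have "finite ?A" by (rule finite_subset) auto
  then have "\<bar>nabla2 n (bcoef n l p) \<gamma> i j\<bar> \<le> Max ?A"
    by (rule Max_ge) (use assms in blast)
  then show ?thesis using assms(1) by (simp add: nabla2_norm_def)
qed

lemma nabla2_norm_nonneg:
  assumes "n \<ge> 1"
  shows "nabla2_norm n l p \<ge> 0"
proof (cases "l < 2")
  case False
  obtain \<gamma> where "\<gamma> \<in> multiidx n (l - 2)" using multiidx_nonempty by blast
  \<comment> \<open>As \<open>n \<ge> 1\<close>, the pair (0, 1) is admissible and the maximum is
    over a nonempty set.\<close>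
  then have "\<bar>nabla2 n (bcoef n l p) \<gamma> 0 1\<bar> \<le> nabla2_norm n l p"
    using False assms by (intro nabla2_norm_bound) auto
  then show ?thesis by linarith
qed (simp add: nabla2_norm_def)

text \<open>The barycentric coordinates of the node are the colour frequencies \<alpha>/k, so the
  two values are the means with and without replacement.\<close>

lemma bcoef_node_bound:
  assumes "n \<ge> 1" and p: "bform n l p" and "l < k" and \<alpha>: "\<alpha> \<in> multiidx n k"
  shows "\<bar>p (node n k \<alpha>) - bcoef n k p \<alpha>\<bar>
    \<le> real (n * (n + 2) * l * (l - 1)) / 24 * nabla2_norm n l p / (real k - 1)"
proof -
  have "avg n (bary n (node n k \<alpha>)) = avg n (\<lambda>i. real (\<alpha> i) / real k)"
    using \<open>l < k\<close> by (intro ext) (simp add: avg_def bary_node[OF \<alpha>])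
  then have "p (node n k \<alpha>) = (avg n (\<lambda>i. real (\<alpha> i) / real k) ^^ l) (bcoef n l p) (\<lambda>_. 0)"
    by (simp add: bform_bcoef[OF p] bernstein_eval)
  moreover have "bcoef n k p \<alpha> = samp n l \<alpha> (bcoef n l p) / falling k l"
    using \<open>l < k\<close> by (intro bcoef_elevate p \<alpha>) simp
  ultimately show ?thesis
    using avg_pow_samp_bound[OF \<alpha> \<open>l < k\<close> nabla2_norm_nonneg[OF \<open>n \<ge> 1\<close>] nabla2_norm_bound] by simp
qed

text \<open>A mean does not fall below the minimum. This bounds the degree \<open>k\<close>
  denominators by the degree \<open>l\<close> minimum that enters \<omega>.\<close>

lemma bcoef_elevate_ge:
  assumes q: "bform n l q" and "l \<le> k" and \<alpha>: "\<alpha> \<in> multiidx n k"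
    and c: "\<And>\<beta>. \<beta> \<in> multiidx n l \<Longrightarrow> c \<le> bcoef n l q \<beta>"
  shows "c \<le> bcoef n k q \<alpha>"
proof -
  have "c * falling k l \<le> samp n l \<alpha> (bcoef n l q)"
    using samp_mono[of n l "\<lambda>_. c" "bcoef n l q" \<alpha>] c \<alpha> by (simp add: samp_const multiidx_def)
  then show ?thesis
    using falling_pos[OF \<open>l \<le> k\<close>] by (simp add: bcoef_elevate[OF q \<open>l \<le> k\<close> \<alpha>] pos_le_divide_eq)
qed

text \<open>The value of p/q is a convex combination of the rational coefficients, with weights
  b_\<alpha>(q) B_\<alpha> / q.\<close>

lemma rational_enclosure:
  assumes p: "bform n k p" and q: "bform n k q"
    and pos: "\<And>\<alpha>. \<alpha> \<in> multiidx n k \<Longrightarrow> bcoef n k q \<alpha> > 0"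
    and x: "x \<in> std_simplex n"
  shows "q x > 0" and "Min (rbcoef n k p q ` multiidx n k) \<le> p x / q x"
    and "p x / q x \<le> Max (rbcoef n k p q ` multiidx n k)"
proof -
  let ?B = "\<lambda>\<alpha>. bernstein n k \<alpha> x" and ?A = "multiidx n k"
  let ?m = "Min (rbcoef n k p q ` ?A)" and ?M = "Max (rbcoef n k p q ` ?A)"
  note B = bernstein_nonneg[OF x, of k]
  define c where "c = Min (bcoef n k q ` ?A)"
  have "c \<in> bcoef n k q ` ?A" unfolding c_def using multiidx_nonempty by (intro Min_in) auto
  then have "c > 0" using pos by auto
  have "c = (\<Sum>\<alpha>\<in>?A. c * ?B \<alpha>)" using sum_bernstein[of n k x] by (simp flip: sum_distrib_left)
  also have "\<dots> \<le> q x"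
    unfolding bform_bcoef[OF q, of x] using B by (intro sum_mono mult_right_mono) (auto simp: c_def)
  finally show qpos: "q x > 0" using \<open>c > 0\<close> by simp
  have px: "p x = (\<Sum>\<alpha>\<in>?A. rbcoef n k p q \<alpha> * (bcoef n k q \<alpha> * ?B \<alpha>))"
    unfolding bform_bcoef[OF p, of x] using pos by (intro sum.cong refl) (force simp: rbcoef_def)
  have qB: "bcoef n k q \<alpha> * ?B \<alpha> \<ge> 0" if "\<alpha> \<in> ?A" for \<alpha>
    using pos[OF that] B[of \<alpha>] by simp
  have "?m * q x \<le> p x"
    unfolding px bform_bcoef[OF q, of x] sum_distrib_left using qB by (intro sum_mono mult_right_mono) auto
  then show "?m \<le> p x / q x" using qpos by (simp add: pos_le_divide_eq)
  have "p x \<le> ?M * q x"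
    unfolding px bform_bcoef[OF q, of x] sum_distrib_left using qB by (intro sum_mono mult_right_mono) auto
  then show "p x / q x \<le> ?M" using qpos by (simp add: pos_divide_le_eq)
qed

theorem theorem4p3:
  fixes n l k :: nat and p q :: "(nat \<Rightarrow> real) \<Rightarrow> real"
  assumes "n \<ge> 1"
    and "poly_of_degree n l p" and "poly_of_degree n l q"
    and "\<And>j \<alpha>. j \<ge> l \<Longrightarrow> \<alpha> \<in> multiidx n j \<Longrightarrow> bcoef n j q \<alpha> > 0"
    and "k > l"
  shows "let \<zeta> = max \<bar>Min (rbcoef n l p q ` multiidx n l)\<bar> \<bar>Max (rbcoef n l p q ` multiidx n l)\<bar>;
             \<omega> = real (n * (n + 2) * l * (l - 1)) / (24 * Min (bcoef n l q ` multiidx n l))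
                  * (nabla2_norm n l p + \<zeta> * nabla2_norm n l q)
         in idist (range_on_simplex n (\<lambda>x. p x / q x)) (bern_encl n k p q) \<le> \<omega> / (real k - 1)"
proof -
  define \<zeta> where "\<zeta> = max \<bar>Min (rbcoef n l p q ` multiidx n l)\<bar> \<bar>Max (rbcoef n l p q ` multiidx n l)\<bar>"
  define c where "c = Min (bcoef n l q ` multiidx n l)"
  define K where "K = real (n * (n + 2) * l * (l - 1)) / 24"
  define err where "err = K / c * (nabla2_norm n l p + \<zeta> * nabla2_norm n l q) / (real k - 1)"
  define f where "f = (\<lambda>x. p x / q x)"
  define r where "r = rbcoef n k p q"
  have p: "bform n l p" and q: "bform n l q" using assms(2,3) by (auto intro: poly_of_degree_bform)
  have pk: "bform n k p" and qk: "bform n k q" using p q \<open>k > l\<close> by (auto intro: bform_mono[of l k])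
  have k: "k > 0" "real k - 1 \<ge> 0" using \<open>k > l\<close> by auto
  have "c \<in> bcoef n l q ` multiidx n l" unfolding c_def using multiidx_nonempty by (intro Min_in) auto
  then have c: "c > 0" using assms(4)[of l] by auto
  \<comment> \<open>The enclosure is applied in degree \<open>l\<close>, where \<zeta> is formed,
    and not in degree \<open>k\<close>.\<close>
  have \<zeta>: "\<bar>f x\<bar> \<le> \<zeta>" if "x \<in> std_simplex n" for x
    using rational_enclosure(2,3)[OF p q assms(4) that] unfolding \<zeta>_def f_def by force
  have near: "\<bar>r \<alpha> - f (node n k \<alpha>)\<bar> \<le> err" if \<alpha>: "\<alpha> \<in> multiidx n k" for \<alpha>
  proof -
    define y where "y = node n k \<alpha>"
    define bp bq where "bp = bcoef n k p \<alpha>" and "bq = bcoef n k q \<alpha>"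
    have y: "y \<in> std_simplex n" unfolding y_def by (intro node_in_simplex \<alpha> k)
    have qy: "q y > 0" by (rule rational_enclosure(1)[OF p q assms(4) y]) auto
    have bq: "c \<le> bq" unfolding bq_def
      by (rule bcoef_elevate_ge[OF q _ \<alpha>]) (use \<open>k > l\<close> in \<open>auto simp: c_def\<close>)
    have dp: "\<bar>p y - bp\<bar> \<le> K * nabla2_norm n l p / (real k - 1)"
      and dq: "\<bar>q y - bq\<bar> \<le> K * nabla2_norm n l q / (real k - 1)"
      unfolding y_def bp_def bq_def K_def
      using bcoef_node_bound[OF assms(1) p \<open>k > l\<close> \<alpha>] bcoef_node_bound[OF assms(1) q \<open>k > l\<close> \<alpha>] by auto
    have "r \<alpha> - f y = ((bp - p y) + f y * (q y - bq)) / bq"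
      using qy bq c by (simp add: r_def rbcoef_def f_def bp_def[symmetric] bq_def[symmetric] field_simps)
    then have "\<bar>r \<alpha> - f y\<bar> = \<bar>(bp - p y) + f y * (q y - bq)\<bar> / bq"
      using bq c by simp
    also have "\<dots> \<le> (K * nabla2_norm n l p / (real k - 1) + \<zeta> * (K * nabla2_norm n l q / (real k - 1))) / c"
    proof (rule frac_le)
      have "\<bar>f y * (q y - bq)\<bar> \<le> \<zeta> * (K * nabla2_norm n l q / (real k - 1))"
        unfolding abs_mult using \<zeta>[OF y] dq by (intro mult_mono) auto
      then show "\<bar>(bp - p y) + f y * (q y - bq)\<bar>
          \<le> K * nabla2_norm n l p / (real k - 1) + \<zeta> * (K * nabla2_norm n l q / (real k - 1))"
        using dp by linarith
      \<comment> \<open>The bound dominates an absolute value; \<open>frac_le\<close> needs its sign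
        to replace \<open>bq\<close> by the smaller \<open>c\<close>.\<close>
      then show "0 \<le> K * nabla2_norm n l p / (real k - 1) + \<zeta> * (K * nabla2_norm n l q / (real k - 1))"
        by linarith
    qed (use bq c in auto)
    also have "\<dots> = err"
      unfolding err_def by (simp add: add_divide_distrib distrib_left mult_ac)
    finally show ?thesis unfolding y_def .
  qed
  have encl: "Min (r ` multiidx n k) \<le> f x" "f x \<le> Max (r ` multiidx n k)" if "x \<in> std_simplex n" for x
    using rational_enclosure(2,3)[OF pk qk assms(4) that] \<open>k > l\<close> by (auto simp: r_def f_def)
  have bdd: "bdd_below (f ` std_simplex n)" "bdd_above (f ` std_simplex n)"
    by (auto intro: bdd_belowI2[OF encl(1)] bdd_aboveI2[OF encl(2)])
  have ne: "std_simplex n \<noteq> {}"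
    using node_in_simplex[OF _ k(1)] multiidx_nonempty by blast
  have fin: "finite (r ` multiidx n k)" "r ` multiidx n k \<noteq> {}" using multiidx_nonempty by auto
  \<comment> \<open>The enclosure contains the range, so only one direction needs an estimate:
    \<open>f\<close> is evaluated at the node of a minimising index.\<close>
  have "\<bar>Inf (f ` std_simplex n) - Min (r ` multiidx n k)\<bar> \<le> err"
  proof -
    obtain \<alpha> where \<alpha>: "\<alpha> \<in> multiidx n k" "Min (r ` multiidx n k) = r \<alpha>" using Min_in[OF fin] by auto
    have "Inf (f ` std_simplex n) \<le> f (node n k \<alpha>)"
      by (intro cINF_lower bdd node_in_simplex \<alpha> k)
    moreover have "Min (r ` multiidx n k) \<le> Inf (f ` std_simplex n)"
      using encl ne by (intro cINF_greatest)
    ultimately show ?thesis using near[OF \<alpha>(1)] \<alpha>(2) by linarith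
  qed
  moreover have "\<bar>Sup (f ` std_simplex n) - Max (r ` multiidx n k)\<bar> \<le> err"
  proof -
    obtain \<alpha> where \<alpha>: "\<alpha> \<in> multiidx n k" "Max (r ` multiidx n k) = r \<alpha>" using Max_in[OF fin] by auto
    have "f (node n k \<alpha>) \<le> Sup (f ` std_simplex n)"
      by (intro cSUP_upper bdd node_in_simplex \<alpha> k)
    moreover have "Sup (f ` std_simplex n) \<le> Max (r ` multiidx n k)"
      using encl ne by (intro cSUP_least)
    ultimately show ?thesis using near[OF \<alpha>(1)] \<alpha>(2) by linarith
  qed
  ultimately have "idist (range_on_simplex n f) (bern_encl n k p q) \<le> err"
    by (simp add: idist_def range_on_simplex_def bern_encl_def r_def)
  then show ?thesis
    by (simp add: Let_def err_def K_def f_def \<zeta>_def c_def)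
qed

end
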